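(* Let $k_1,\dots,k_s$ be positive integers, put $k:=\max_{i\in[s]}k_i$, and assume $n\ge12ks\log(e^2s)$. If $\mathcal F_1\subset\binom{[n]}{k_1},\dots,\mathcal F_s\subset\binom{[n]}{k_s}$ are cross-dependent, then there exists $i\in[s]$ such that $$|\mathcal F_i|\le\binom{n}{k_i}-\binom{n-s+1}{k_i}.$$
   Context: $\log$ is the natural logarithm. $\binom{[n]}{k}$ is the family of $k$-subsets of $[n]=\{1,\dots,n\}$. Families $\mathcal F_1,\dots,\mathcal F_s$ are cross-dependent if there is no choice of $F_1\in\mathcal F_1,\dots,F_s\in\mathcal F_s$ with the $F_i$ pairwise disjoint. *)

theory Defs
  imports Complex_Main "HOL-Library.Ramsey" "HOL-Library.Disjoint_Sets"
begin

(* Disjointness is required per pair of distinct indices: disjoint_family_on does not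
   exempt equal sets chosen at two different indices. *)
definition cross_dependent :: "nat \<Rightarrow> (nat \<Rightarrow> 'a set set) \<Rightarrow> bool" where
  "cross_dependent s \<F> \<longleftrightarrow>
     \<not> (\<exists>F. (\<forall>i\<in>{1..s}. F i \<in> \<F> i) \<and> disjoint_family_on F {1..s})"

end

theory Submission
  imports Defs "HOL-Analysis.Complex_Transcendental"
begin

text \<open>
  Shifting preserves cross-dependence and cardinalities, so the families may be taken to be shifted.
  If a shifted family misses a set \<open>{a\<^sub>0 < a\<^sub>1 < \<dots>}\<close>, then each of its members has, for
  some \<open>j\<close>, more than \<open>j\<close> elements below \<open>a\<^sub>j\<close>. There are few such sets when \<open>a\<^sub>j\<close>
  is about \<open>j * s\<close> or smaller, because a random \<open>k\<close>-set has its \<open>j\<close>-th element near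
  \<open>j * n / k\<close>. Assuming that all families are too large, one can therefore prescribe \<open>s\<close>
  disjoint sets belonging to the respective families, as follows.

  Let \<open>J\<close> be the least number, at least about \<open>ln s\<close>, such that some family \<open>p\<close> contains
  a set starting with \<open>s, \<dots>, s + J - 1\<close> and continuing in steps of \<open>s\<close>. As many other
  families as possible receive distinct first elements \<open>v = 1, \<dots>, m\<close> with all further elements
  beyond \<open>J * s\<close>; such a set exists once a positive proportion of all possible members with
  minimum \<open>v\<close> is present. For the other \<open>d = s - 1 - m\<close> families few members have their
  minimum in \<open>{m + 1..<s}\<close>, so most of the excess lies beyond, and there is room for rows of
  \<open>d\<close> elements up to \<open>J * s\<close>. If \<open>J\<close> exceeds its lower bound, then no family contains a
  set with the shorter start \<open>s, \<dots>, s + J - 2\<close>; hence hardly any member of any family lies in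
  \<open>{s..n}\<close>, almost all sets meeting \<open>{1..<s}\<close> are members, and \<open>d = 0\<close>.
\<close>

section \<open>Counting\<close>

lemma card_nsets: "finite A \<Longrightarrow> card (nsets A r) = card A choose r"
  unfolding nsets_def
  by (subst n_subsets[symmetric]) (auto intro: arg_cong[where f = card] finite_subset)

lemma card_nsets_supersets:
  assumes "finite I" "Q \<subseteq> I" "card Q \<le> r"
  shows "card {B \<in> nsets I r. Q \<subseteq> B} = (card I - card Q) choose (r - card Q)"
proof -
  have finQ: "finite Q" using assms finite_subset by blast
  have "bij_betw (\<lambda>B. B - Q) {B \<in> nsets I r. Q \<subseteq> B} (nsets (I - Q) (r - card Q))"
  proof (rule bij_betw_byWitness[where f' = "\<lambda>B. B \<union> Q"])
    show "(\<lambda>B. B - Q) ` {B \<in> nsets I r. Q \<subseteq> B} \<subseteq> nsets (I - Q) (r - card Q)"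
      using finQ by (auto simp: nsets_def card_Diff_subset)
    show "(\<lambda>B. B \<union> Q) ` nsets (I - Q) (r - card Q) \<subseteq> {B \<in> nsets I r. Q \<subseteq> B}"
    proof clarify
      fix B assume B: "B \<in> nsets (I - Q) (r - card Q)"
      then have "card (B \<union> Q) = card B + card Q"
        using finQ by (intro card_Un_disjoint) (auto simp: nsets_def)
      then show "B \<union> Q \<in> nsets I r \<and> Q \<subseteq> B \<union> Q"
        using B finQ assms by (auto simp: nsets_def)
    qed
  qed (auto simp: nsets_def)
  then have "card {B \<in> nsets I r. Q \<subseteq> B} = card (nsets (I - Q) (r - card Q))"
    by (rule bij_betw_same_card)
  then show ?thesis
    using assms finQ by (simp add: card_nsets card_Diff_subset)
qed

text \<open>Union bound over the \<open>j\<close>-subsets \<open>Q\<close> of \<open>T\<close> that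
  a counted set can contain.\<close>

lemma card_nsets_meeting_le:
  assumes "finite I" "T \<subseteq> I" "j \<le> r"
  shows "card {B \<in> nsets I r. j \<le> card (B \<inter> T)} \<le> (card T choose j) * ((card I - j) choose (r - j))"
proof -
  have finT: "finite T" using assms finite_subset by blast
  have "{B \<in> nsets I r. j \<le> card (B \<inter> T)} \<subseteq> (\<Union>Q\<in>nsets T j. {B \<in> nsets I r. Q \<subseteq> B})"
  proof
    fix B assume B: "B \<in> {B \<in> nsets I r. j \<le> card (B \<inter> T)}"
    then obtain Q where "Q \<subseteq> B \<inter> T" "card Q = j" "finite Q"
      using obtain_subset_with_card_n[of j "B \<inter> T"] by auto
    then show "B \<in> (\<Union>Q\<in>nsets T j. {B \<in> nsets I r. Q \<subseteq> B})"
      using B by (auto simp: nsets_def)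
  qed
  then have "card {B \<in> nsets I r. j \<le> card (B \<inter> T)}
      \<le> card (\<Union>Q\<in>nsets T j. {B \<in> nsets I r. Q \<subseteq> B})"
    using assms(1) finT by (intro card_mono) (auto simp: finite_imp_finite_nsets)
  also have "\<dots> \<le> (\<Sum>Q\<in>nsets T j. card {B \<in> nsets I r. Q \<subseteq> B})"
    using finT by (intro card_UN_le finite_imp_finite_nsets)
  also have "\<dots> = (\<Sum>Q\<in>nsets T j. (card I - j) choose (r - j))"
  proof (rule sum.cong)
    fix Q assume "Q \<in> nsets T j"
    then show "card {B \<in> nsets I r. Q \<subseteq> B} = (card I - j) choose (r - j)"
      using card_nsets_supersets[of I Q r] assms by (auto simp: nsets_def)
  qed simp
  also have "\<dots> = (card T choose j) * ((card I - j) choose (r - j))"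
    using finT by (simp add: card_nsets)
  finally show ?thesis .
qed

text \<open>Lowering both arguments by one multiplies the coefficient by \<open>r / p\<close>, which
  is at most \<open>z\<close>; since \<open>z \<le> 1\<close>, the ratio hypothesis survives for
  \<open>r - 1\<close> and \<open>p - 1\<close>.\<close>

lemma binomial_diff_le_power:
  fixes z :: real
  assumes "i \<le> r" "r \<le> p" "real r \<le> z * real p" "0 \<le> z" "z \<le> 1"
  shows "real ((p - i) choose (r - i)) \<le> z ^ i * real (p choose r)"
  using assms
proof (induction i arbitrary: p r)
  case (Suc i)
  then obtain p' r' where pr: "p = Suc p'" "r = Suc r'"
    by (metis Suc_le_D le_trans)
  have "real (Suc r') * real (Suc p' choose Suc r') = real (Suc p') * real (p' choose r')"
    by (metis Suc_times_binomial of_nat_mult)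
  moreover have "real (Suc r') * real (Suc p' choose Suc r') \<le> z * real (Suc p') * real (Suc p' choose Suc r')"
    using Suc.prems pr by (intro mult_right_mono) auto
  ultimately have "real (Suc p') * real (p' choose r') \<le> real (Suc p') * (z * real (Suc p' choose Suc r'))"
    by (simp add: mult_ac)
  then have 1: "real (p' choose r') \<le> z * real (Suc p' choose Suc r')"
    by (subst (asm) mult_le_cancel_left_pos) auto
  have "real r' \<le> z * real p'"
    using Suc.prems(3,5) pr by (simp add: algebra_simps)
  then have "real ((p' - i) choose (r' - i)) \<le> z ^ i * real (p' choose r')"
    using Suc.prems pr by (intro Suc.IH) auto
  also have "\<dots> \<le> z ^ i * (z * real (Suc p' choose Suc r'))"
    using 1 Suc.prems by (intro mult_left_mono) auto
  finally show ?case using pr by (simp add: mult_ac)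
qed auto

text \<open>By Pascal's rule, deleting \<open>t\<close> points costs at most \<open>t\<close> times
  \<open>(p - 1) choose (r - 1)\<close>, and that coefficient is the fraction \<open>r / p\<close>
  of \<open>p choose r\<close>.\<close>

lemma binomial_sub_ge:
  fixes z :: real
  assumes "t + r \<le> p" "real r \<le> z * real p"
  shows "(1 - real t * z) * real (p choose r) \<le> real ((p - t) choose r)"
proof (cases "r = 0")
  case True
  then have "0 \<le> z \<or> p = 0"
    using assms(2) by (auto simp: zero_le_mult_iff)
  then show ?thesis using True assms by auto
next
  case False
  then have p0: "0 < p" using assms by simp
  have r0: "0 < real r" using False by simp
  have z: "0 < z" using r0 assms(2) p0 by (metis less_le_trans of_nat_0_less_iff zero_less_mult_pos2)
  have step: "real (q choose r) \<le> real ((q - u) choose r) + real u * real ((q - 1) choose (r - 1))"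
    if "u \<le> q" for q u
    using that
  proof (induction u)
    case (Suc u)
    have "real ((q - u) choose r) = real ((q - Suc u) choose r) + real ((q - Suc u) choose (r - 1))"
      using Suc.prems False
      by (metis (no_types, lifting) Suc_diff_Suc Suc_le_lessD add.commute binomial_Suc_Suc not0_implies_Suc
          of_nat_add diff_Suc_1)
    moreover have "(q - Suc u) choose (r - 1) \<le> (q - 1) choose (r - 1)"
      by (intro binomial_right_mono) auto
    ultimately show ?case
      using Suc by (simp add: algebra_simps)
  qed auto
  have "real r * real (p choose r) = real p * real ((p - 1) choose (r - 1))"
    by (metis False bot_nat_0.not_eq_extremum of_nat_mult times_binomial_minus1_eq)
  moreover have "real r * real (p choose r) \<le> z * real p * real (p choose r)"
    using assms by (intro mult_right_mono) auto
  ultimately have "real p * real ((p - 1) choose (r - 1)) \<le> real p * (z * real (p choose r))"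
    by (simp add: mult_ac)
  then have "real ((p - 1) choose (r - 1)) \<le> z * real (p choose r)"
    using p0 by (subst (asm) mult_le_cancel_left_pos) auto
  then have "real t * real ((p - 1) choose (r - 1)) \<le> real t * (z * real (p choose r))"
    by (intro mult_left_mono) auto
  then show ?thesis
    using step[of t p] assms by (simp add: algebra_simps)
qed

lemma power_div_fact_le_exp:
  fixes x :: real
  assumes "0 \<le> x"
  shows "x ^ i / fact i \<le> exp x"
proof -
  have "(\<Sum>j\<in>{i}. x ^ j /\<^sub>R fact j) \<le> (\<Sum>j. x ^ j /\<^sub>R fact j)"
    using assms by (intro sum_le_suminf summable_exp_generic) (auto simp: scaleR_conv_of_real)
  then show ?thesis
    by (simp add: exp_def divide_inverse mult.commute)
qed

text \<open>The factor \<open>i ^ i / fact i\<close> produced by \<open>t \<le> i * w\<close> is a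
  single term of the series of \<open>exp i\<close>.\<close>

lemma binomial_le_exp_power:
  fixes w :: real
  assumes "real t \<le> real i * w" "0 \<le> w"
  shows "real (t choose i) \<le> (exp 1 * w) ^ i"
proof -
  have "real (t choose i) * fact i \<le> real t ^ i"
    by (metis binomial_fact_pow of_nat_fact of_nat_le_iff of_nat_mult of_nat_power)
  then have "real (t choose i) \<le> real t ^ i / fact i"
    by (simp add: pos_le_divide_eq)
  also have "\<dots> \<le> (real i * w) ^ i / fact i"
    using assms by (intro divide_right_mono power_mono) auto
  also have "\<dots> = w ^ i * (real i ^ i / fact i)"
    by (simp add: power_mult_distrib)
  also have "\<dots> \<le> w ^ i * exp (real i)"
    using assms by (intro mult_left_mono power_div_fact_le_exp) auto
  also have "\<dots> = (exp 1 * w) ^ i"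
    by (simp add: power_mult_distrib exp_of_nat_mult[symmetric])
  finally show ?thesis .
qed

lemma sum_power_tail_le:
  fixes q :: real
  assumes "0 \<le> q" "q < 1"
  shows "(\<Sum>j\<in>{a..<b}. q ^ j) \<le> q ^ a / (1 - q)"
proof (cases "a \<le> b")
  case True
  then have "(\<Sum>j\<in>{a..<b}. q ^ j) * (1 - q) = q ^ a - q ^ b"
    by (induction rule: dec_induct) (simp_all add: distrib_right right_diff_distrib)
  also have "\<dots> \<le> q ^ a"
    using assms by simp
  finally show ?thesis
    using assms by (simp add: pos_le_divide_eq)
qed (use assms in auto)

section \<open>Shifted families\<close>

definition shift_closed :: "nat set set \<Rightarrow> bool" where
  "shift_closed G \<longleftrightarrow>
     (\<forall>F\<in>G. \<forall>x y. 1 \<le> x \<longrightarrow> x < y \<longrightarrow> y \<in> F \<longrightarrow> x \<notin> F \<longrightarrow> insert x (F - {y}) \<in> G)"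

text \<open>The usual compression: \<open>F\<close> stays put when its shifted copy is already
  present, which makes the map injective on \<open>G\<close>.\<close>

definition shift :: "nat \<Rightarrow> nat \<Rightarrow> nat set set \<Rightarrow> nat set \<Rightarrow> nat set" where
  "shift x y G F =
     (if y \<in> F \<and> x \<notin> F \<and> insert x (F - {y}) \<notin> G then insert x (F - {y}) else F)"

lemma shift_cases:
  "shift x y G F = F \<and> (y \<in> F \<longrightarrow> x \<notin> F \<longrightarrow> insert x (F - {y}) \<in> G)
    \<or> shift x y G F = insert x (F - {y}) \<and> y \<in> F \<and> x \<notin> F"
  by (auto simp: shift_def)

lemma inj_on_shift:
  assumes "x \<noteq> y"
  shows "inj_on (shift x y G) G"
proof (rule inj_onI)
  fix A B assume AB: "A \<in> G" "B \<in> G" and eq: "shift x y G A = shift x y G B"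
  have "A = B" if "y \<in> A" "y \<in> B" "x \<notin> A" "x \<notin> B" "insert x (A - {y}) = insert x (B - {y})"
    using that by (metis Diff_insert_absorb insert_Diff insert_Diff_single insert_iff)
  then show "A = B"
    using AB eq by (auto simp: shift_def split: if_splits)
qed

lemma shift_in_nsets:
  assumes "F \<in> nsets {1..n} r" "1 \<le> x" "x < y"
  shows "shift x y G F \<in> nsets {1..n} r"
proof -
  have "card (insert x (F - {y})) = card F" if "y \<in> F" "x \<notin> F"
    using that assms card.remove[of F y] by (simp add: nsets_def)
  then show ?thesis
    using assms by (auto simp: shift_def nsets_def)
qed

lemma sum_shift:
  fixes x y :: nat
  assumes "finite F" "y \<in> F" "x \<notin> F"
  shows "\<Sum>(insert x (F - {y})) + y = \<Sum>F + x"
  using assms by (simp add: sum.remove[of F y])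

lemma sum_shift_le:
  assumes "finite F" "x < y"
  shows "\<Sum>(shift x y G F) \<le> \<Sum>F"
  using sum_shift[of F y x] assms by (auto simp: shift_def)

text \<open>At most one of the pairwise disjoint members contains \<open>x\<close>, so at most one of them is new.
  If another one contains \<open>y\<close>, it was kept because its own shift was already present, and the two
  can exchange \<open>x\<close> and \<open>y\<close>.\<close>
lemma cross_dependent_shift:
  assumes dep: "cross_dependent s \<F>" and "x < y"
  shows "cross_dependent s (\<lambda>i. shift x y (\<F> i) ` \<F> i)"
  unfolding cross_dependent_def
proof (rule notI, elim exE conjE)
  fix A assume mem: "\<forall>i\<in>{1..s}. A i \<in> shift x y (\<F> i) ` \<F> i"
    and disj: "disjoint_family_on A {1..s}"
  have dis: "A i \<inter> A j = {}" if "i \<in> {1..s}" "j \<in> {1..s}" "i \<noteq> j" for i j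
    using disj that by (auto simp: disjoint_family_on_def)
  have no: "\<not> ((\<forall>i\<in>{1..s}. B i \<in> \<F> i) \<and> disjoint_family_on B {1..s})" for B
    using dep unfolding cross_dependent_def by blast
  have old_or_new: "A i \<in> \<F> i \<or> (x \<in> A i \<and> y \<notin> A i \<and> insert y (A i - {x}) \<in> \<F> i)"
    if "i \<in> {1..s}" for i
  proof -
    obtain F where F: "F \<in> \<F> i" "A i = shift x y (\<F> i) F"
      using mem \<open>i \<in> {1..s}\<close> by blast
    show ?thesis
    proof (cases "A i = F")
      case False
      then have "y \<in> F" "x \<notin> F" "A i = insert x (F - {y})"
        using F by (auto simp: shift_def split: if_splits)
      moreover have "insert y (A i - {x}) = F"
        using calculation \<open>x < y\<close> by auto
      ultimately show ?thesis using F \<open>x < y\<close> by auto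
    qed (use F in simp)
  qed
  have swap: "insert x (A i - {y}) \<in> \<F> i" if "i \<in> {1..s}" "y \<in> A i" "x \<notin> A i" for i
  proof -
    from mem that(1) have "A i \<in> shift x y (\<F> i) ` \<F> i" by (rule bspec)
    then obtain F where F: "F \<in> \<F> i" "A i = shift x y (\<F> i) F" by (elim imageE)
    have "shift x y (\<F> i) F \<noteq> insert x (F - {y})"
      using that(3) F(2) by (metis insertI1)
    then have "A i = F" "y \<in> F \<longrightarrow> x \<notin> F \<longrightarrow> insert x (F - {y}) \<in> \<F> i"
      using shift_cases[of x y "\<F> i" F] F(2) by metis+
    then show ?thesis using that by metis
  qed
  obtain p where p: "p \<in> {1..s}" "A p \<notin> \<F> p"
    using no[of A] disj by auto
  then have xp: "x \<in> A p" "y \<notin> A p" "insert y (A p - {x}) \<in> \<F> p"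
    using old_or_new[of p] by auto
  have others: "A i \<in> \<F> i" "x \<notin> A i" if "i \<in> {1..s}" "i \<noteq> p" for i
    using old_or_new[of i] dis[of i p] that p xp by auto
  define B where "B i = (if i = p then insert y (A p - {x})
    else if y \<in> A i then insert x (A i - {y}) else A i)" for i
  have "\<forall>i\<in>{1..s}. B i \<in> \<F> i"
  proof
    fix i assume i: "i \<in> {1..s}"
    show "B i \<in> \<F> i"
      using xp(3) others[OF i] swap[OF i] unfolding B_def by presburger
  qed
  moreover have "B i \<inter> B j = {}" if ij: "i \<in> {1..s}" "j \<in> {1..s}" "i \<noteq> j" for i j
  proof -
    have p_new: "B p \<inter> B l = {}" if l: "l \<in> {1..s}" "l \<noteq> p" for l
      using dis[OF l(1) p(1) l(2)] others(2)[OF l] xp(1,2) \<open>x < y\<close> l(2) unfolding B_def by auto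
    consider "i = p" | "j = p" | "i \<noteq> p" "j \<noteq> p" by blast
    then show ?thesis
    proof cases
      case 3
      then show ?thesis
        using dis[OF ij] others(2)[OF ij(1)] others(2)[OF ij(2)] unfolding B_def by auto
    qed (use p_new ij in \<open>auto simp: Int_commute\<close>)
  qed
  then have "disjoint_family_on B {1..s}"
    by (simp add: disjoint_family_on_def)
  ultimately show False using no[of B] by blast
qed

text \<open>Among all cross-dependent families of the given sizes, one with least total sum of
  elements is taken; a shift that still moved some set would lower this sum.\<close>

lemma ex_shift_closed_families:
  assumes sub: "\<And>i. i \<in> {1..s} \<Longrightarrow> \<F> i \<subseteq> nsets {1..n} (k i)"
    and dep: "cross_dependent s \<F>"
  obtains \<G> where "\<And>i. i \<in> {1..s} \<Longrightarrow> \<G> i \<subseteq> nsets {1..n} (k i)"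
    and "\<And>i. i \<in> {1..s} \<Longrightarrow> card (\<G> i) = card (\<F> i)"
    and "cross_dependent s \<G>"
    and "\<And>i. i \<in> {1..s} \<Longrightarrow> shift_closed (\<G> i)"
proof -
  define P where "P \<G> \<longleftrightarrow> (\<forall>i\<in>{1..s}. \<G> i \<subseteq> nsets {1..n} (k i) \<and> card (\<G> i) = card (\<F> i))
      \<and> cross_dependent s \<G>" for \<G>
  define \<mu> where "\<mu> \<G> = (\<Sum>i\<in>{1..s}. \<Sum>F\<in>\<G> i. \<Sum>F)" for \<G> :: "nat \<Rightarrow> nat set set"
  have "P \<F>" using sub dep by (auto simp: P_def)
  then obtain \<G> where P: "P \<G>" and min: "\<And>\<H>. P \<H> \<Longrightarrow> \<mu> \<G> \<le> \<mu> \<H>"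
    using ex_has_least_nat[of P \<F> \<mu>] by blast
  have "shift_closed (\<G> p)" if p: "p \<in> {1..s}" for p
  proof (rule ccontr)
    assume "\<not> shift_closed (\<G> p)"
    then obtain F x y where F: "F \<in> \<G> p" "1 \<le> x" "x < y" "y \<in> F" "x \<notin> F"
        "insert x (F - {y}) \<notin> \<G> p"
      by (auto simp: shift_closed_def)
    define \<H> where "\<H> i = shift x y (\<G> i) ` \<G> i" for i
    have inj: "inj_on (shift x y (\<G> i)) (\<G> i)" for i
      using F by (intro inj_on_shift) auto
    have "P \<H>"
      unfolding P_def
    proof (intro conjI ballI)
      fix i assume "i \<in> {1..s}"
      then show "\<H> i \<subseteq> nsets {1..n} (k i)"
        using P shift_in_nsets[of _ n "k i" x y "\<G> i"] F unfolding P_def \<H>_def by blast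
      show "card (\<H> i) = card (\<F> i)"
        using P inj \<open>i \<in> {1..s}\<close> by (simp add: \<H>_def card_image P_def)
    next
      show "cross_dependent s \<H>"
        using cross_dependent_shift[of s \<G> x y] P F by (simp add: P_def \<H>_def[abs_def])
    qed
    have fin: "finite (\<G> i)" "\<And>A. A \<in> \<G> i \<Longrightarrow> finite A" if "i \<in> {1..s}" for i
    proof -
      have "\<G> i \<subseteq> nsets {1..n} (k i)" using P that by (simp add: P_def)
      then show "finite (\<G> i)" "\<And>A. A \<in> \<G> i \<Longrightarrow> finite A"
        by (auto simp: finite_imp_finite_nsets nsets_def intro: finite_subset)
    qed
    have \<mu>\<H>: "\<mu> \<H> = (\<Sum>i\<in>{1..s}. \<Sum>A\<in>\<G> i. \<Sum>(shift x y (\<G> i) A))"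
      unfolding \<mu>_def \<H>_def by (subst sum.reindex[OF inj]) (simp add: o_def)
    have le: "(\<Sum>A\<in>\<G> i. \<Sum>(shift x y (\<G> i) A)) \<le> (\<Sum>A\<in>\<G> i. \<Sum>A)" if "i \<in> {1..s}" for i
      using fin that F by (intro sum_mono sum_shift_le) auto
    have "(\<Sum>A\<in>\<G> p. \<Sum>(shift x y (\<G> p) A)) < (\<Sum>A\<in>\<G> p. \<Sum>A)"
    proof (rule sum_strict_mono_ex1)
      have "\<Sum>(shift x y (\<G> p) F) < \<Sum>F"
        using F sum_shift[of F y x] fin[OF p] by (auto simp: shift_def)
      then show "\<exists>A\<in>\<G> p. \<Sum>(shift x y (\<G> p) A) < \<Sum>A" using F by blast
    qed (use fin[OF p] F in \<open>auto intro: sum_shift_le\<close>)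
    then have "\<mu> \<H> < \<mu> \<G>"
      unfolding \<mu>\<H> unfolding \<mu>_def using le p by (intro sum_strict_mono_ex1) auto
    then show False using min[OF \<open>P \<H>\<close>] by simp
  qed
  then show ?thesis
    using that[of \<G>] P by (auto simp: P_def)
qed

text \<open>The least element \<open>y\<close> of \<open>F\<close> outside \<open>A\<close> is
  exchanged for a smaller element of \<open>A\<close> outside \<open>F\<close>. This keeps the set
  in \<open>G\<close>, preserves the domination and shrinks \<open>F - A\<close>.\<close>

lemma shift_closed_dominated:
  assumes G: "shift_closed G" "F \<in> G" and "finite F" "finite A" "card A = card F"
    and "A \<subseteq> {1..}" "F \<subseteq> {1..}"
    and dom: "\<And>t. card (F \<inter> {1..t}) \<le> card (A \<inter> {1..t})"
  shows "A \<in> G"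
  using assms(2-)
proof (induction "card (F - A)" arbitrary: F rule: less_induct)
  case less
  show ?case
  proof (cases "F = A")
    case False
    have "\<not> F \<subseteq> A"
      using False less.prems by (metis card_subset_eq)
    then have ne: "F - A \<noteq> {}" by blast
    define y where "y = Min (F - A)"
    have y: "y \<in> F" "y \<notin> A"
      using Min_in[of "F - A"] ne less.prems by (auto simp: y_def)
    have below: "z \<in> A" if "z \<in> F" "z < y" for z
      using that less.prems Min_le[of "F - A" z] unfolding y_def by (metis Diff_iff finite_Diff not_le)
    \<comment> \<open>Otherwise \<open>F\<close> contains all elements of \<open>A\<close> up to
      \<open>y\<close> and also \<open>y\<close> itself, against the domination at
      \<open>t = y\<close>.\<close>
    have "\<exists>x<y. x \<in> A - F"
    proof (rule ccontr)
      assume "\<not> ?thesis"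
      then have "A \<inter> {1..y} \<subseteq> F \<inter> {1..y}"
        using y by (auto simp: nat_less_le)
      moreover have "y \<in> F \<inter> {1..y}" "y \<notin> A \<inter> {1..y}"
        using y less.prems by auto
      ultimately have "A \<inter> {1..y} \<subset> F \<inter> {1..y}" by blast
      then have "card (A \<inter> {1..y}) < card (F \<inter> {1..y})"
        by (intro psubset_card_mono) auto
      then show False using less.prems(7)[of y] by simp
    qed
    then obtain x where x: "x < y" "x \<in> A" "x \<notin> F" by blast
    have x1: "1 \<le> x" using x less.prems by auto
    define F' where "F' = insert x (F - {y})"
    have F': "F' \<in> G"
      using G(1) less.prems x y x1 unfolding shift_closed_def F'_def by blast
    have cF': "card F' = card F"
      using less.prems(2) x y card.remove[of F y] by (simp add: F'_def)
    have "F' - A = (F - A) - {y}"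
      using x y by (auto simp: F'_def)
    then have lt: "card (F' - A) < card (F - A)"
      using y less.prems(2) card_Diff1_less[of "F - A" y] by simp
    \<comment> \<open>Below \<open>y\<close> the new set lies inside \<open>A\<close>; from
      \<open>y\<close> on the exchange leaves the count unchanged.\<close>
    have "card (F' \<inter> {1..t}) \<le> card (A \<inter> {1..t})" for t
    proof (cases "t < y")
      case True
      then have "F' \<inter> {1..t} \<subseteq> A \<inter> {1..t}"
        using below x by (auto simp: F'_def)
      then show ?thesis by (intro card_mono) auto
    next
      case False
      then have "F' \<inter> {1..t} = insert x ((F \<inter> {1..t}) - {y})"
        using x x1 y by (auto simp: F'_def)
      then have "card (F' \<inter> {1..t}) = card (F \<inter> {1..t})"
        using x y x1 False card.remove[of "F \<inter> {1..t}" y] by simp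
      then show ?thesis using less.prems(7)[of t] by simp
    qed
    then show ?thesis
      using less.hyps[OF lt F'] less.prems(2-6) cF' x1 by (auto simp: F'_def)
  qed (use less.prems(1) in simp)
qed

text \<open>The last hypothesis says that the \<open>j\<close>-th smallest element of \<open>F\<close>, counted from 0, is at
  least \<open>a j\<close>.\<close>
lemma shift_closed_pattern:
  assumes G: "shift_closed G" "G \<subseteq> nsets {1..n} r" "F \<in> G"
    and a: "strict_mono a" "1 \<le> a 0"
    and F: "\<And>j. j < r \<Longrightarrow> card (F \<inter> {1..<a j}) \<le> j"
  shows "a ` {..<r} \<in> G"
proof (rule shift_closed_dominated[OF G(1,3)])
  have Fn: "finite F" "card F = r" "F \<subseteq> {1..n}" using G by (auto simp: nsets_def)
  have inj: "inj_on a S" for S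
    using a(1) strict_mono_imp_inj_on inj_on_subset by blast
  show "finite F" "F \<subseteq> {1..}" using Fn by auto
  show "card (a ` {..<r}) = card F" using inj Fn by (simp add: card_image)
  show "finite (a ` {..<r})" by simp
  have pos: "1 \<le> a j" for j
    using a by (metis le_trans strict_mono_less_eq zero_le)
  then show "a ` {..<r} \<subseteq> {1..}" by auto
  fix t
  show "card (F \<inter> {1..t}) \<le> card (a ` {..<r} \<inter> {1..t})"
  proof (cases "\<exists>j<r. t < a j")
    case True
    \<comment> \<open>By minimality the \<open>j\<close> entries before \<open>a j\<close> are all
      at most \<open>t\<close>, while \<open>F\<close> has at most \<open>j\<close> elements below
      \<open>a j\<close>.\<close>
    define j where "j = (LEAST j. t < a j)"
    have j: "t < a j" "j < r"
    proof -
      obtain i where i: "i < r" "t < a i" using True by blast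
      show "t < a j" unfolding j_def using i(2) by (rule LeastI)
      show "j < r" using Least_le[of "\<lambda>j. t < a j" i] i unfolding j_def by simp
    qed
    have "a i \<le> t" if "i < j" for i
      using not_less_Least[of i "\<lambda>j. t < a j"] that unfolding j_def by simp
    then have "a ` {..<j} \<subseteq> a ` {..<r} \<inter> {1..t}"
      using j(2) pos by auto
    then have "card (a ` {..<j}) \<le> card (a ` {..<r} \<inter> {1..t})"
      by (intro card_mono) auto
    moreover have "card (F \<inter> {1..t}) \<le> card (F \<inter> {1..<a j})"
      using j by (intro card_mono) auto
    ultimately show ?thesis
      using F[OF j(2)] inj by (simp add: card_image)
  next
    case False
    then have "a i \<le> t" if "i < r" for i
      using that not_less by blast
    then have "a ` {..<r} \<subseteq> {1..t}" using pos by auto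
    then have "a ` {..<r} \<inter> {1..t} = a ` {..<r}" by blast
    then show ?thesis
      using Fn inj card_mono[of F "F \<inter> {1..t}"] by (simp add: card_image)
  qed
qed

text \<open>If \<open>b i < a j\<close> then \<open>b i < b j\<close>, hence \<open>i < j\<close>;
  so at most \<open>j\<close> entries of \<open>b\<close> lie below \<open>a j\<close>.\<close>

lemma shift_closed_pattern_mono:
  assumes G: "shift_closed G" "G \<subseteq> nsets {1..n} r"
    and b: "strict_mono b" "b ` {..<r} \<in> G"
    and a: "strict_mono a" "1 \<le> a 0"
    and le: "\<And>j. j < r \<Longrightarrow> a j \<le> b j"
  shows "a ` {..<r} \<in> G"
proof (rule shift_closed_pattern[OF G b(2) a])
  fix j assume j: "j < r"
  have "b ` {..<r} \<inter> {1..<a j} \<subseteq> b ` {..<j}"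
  proof clarify
    fix i assume "b i \<in> {1..<a j}"
    then have "b i < b j" using le[OF j] by simp
    then have "i < j" using b(1) by (simp add: strict_mono_less)
    then show "b i \<in> b ` {..<j}" by simp
  qed
  then have "card (b ` {..<r} \<inter> {1..<a j}) \<le> card (b ` {..<j})"
    by (intro card_mono) auto
  also have "\<dots> \<le> j" using card_image_le[of "{..<j}" b] by simp
  finally show "card (b ` {..<r} \<inter> {1..<a j}) \<le> j" .
qed

section \<open>Crowded sets\<close>

lemma card_crowded_le_sum:
  assumes "finite I" "finite S" "S \<subseteq> {..<r}"
  shows "card {B \<in> nsets I r. \<exists>j\<in>S. Suc j \<le> card (B \<inter> T j)}
    \<le> (\<Sum>j\<in>S. (card (T j \<inter> I) choose Suc j) * ((card I - Suc j) choose (r - Suc j)))"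
proof -
  have "{B \<in> nsets I r. \<exists>j\<in>S. Suc j \<le> card (B \<inter> T j)}
      \<subseteq> (\<Union>j\<in>S. {B \<in> nsets I r. Suc j \<le> card (B \<inter> (T j \<inter> I))})"
  proof clarify
    fix B j assume B: "B \<in> nsets I r" "j \<in> S" "Suc j \<le> card (B \<inter> T j)"
    moreover have "B \<inter> (T j \<inter> I) = B \<inter> T j"
      using B(1) by (auto simp: nsets_def)
    ultimately show "B \<in> (\<Union>j\<in>S. {B \<in> nsets I r. Suc j \<le> card (B \<inter> (T j \<inter> I))})"
      by (intro UN_I[OF B(2)]) simp
  qed
  then have "card {B \<in> nsets I r. \<exists>j\<in>S. Suc j \<le> card (B \<inter> T j)}
      \<le> card (\<Union>j\<in>S. {B \<in> nsets I r. Suc j \<le> card (B \<inter> (T j \<inter> I))})"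
    using assms by (intro card_mono) (auto simp: finite_imp_finite_nsets)
  also have "\<dots> \<le> (\<Sum>j\<in>S. card {B \<in> nsets I r. Suc j \<le> card (B \<inter> (T j \<inter> I))})"
    using assms by (intro card_UN_le)
  also have "\<dots> \<le> (\<Sum>j\<in>S. (card (T j \<inter> I) choose Suc j) * ((card I - Suc j) choose (r - Suc j)))"
    using assms by (intro sum_mono card_nsets_meeting_le) auto
  finally show ?thesis .
qed

text \<open>With windows \<open>T j\<close> of at most \<open>w\<close> points per index and density
  at most \<open>z\<close>, the union bound becomes a geometric series.\<close>

lemma card_crowded_le:
  fixes w z :: real
  assumes "finite I" "finite S" "S \<subseteq> {..<r}" "r \<le> card I"
    and "real r \<le> z * real (card I)" "0 \<le> z" "z \<le> 1" "0 \<le> w"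
    and T: "\<And>j. j \<in> S \<Longrightarrow> real (card (T j \<inter> I)) \<le> real (Suc j) * w"
  shows "real (card {B \<in> nsets I r. \<exists>j\<in>S. Suc j \<le> card (B \<inter> T j)})
    \<le> (\<Sum>j\<in>S. (exp 1 * w * z) ^ Suc j) * real (card I choose r)"
proof -
  have "real (card {B \<in> nsets I r. \<exists>j\<in>S. Suc j \<le> card (B \<inter> T j)})
      \<le> (\<Sum>j\<in>S. real (card (T j \<inter> I) choose Suc j) * real ((card I - Suc j) choose (r - Suc j)))"
    using card_crowded_le_sum[OF assms(1-3), of T]
    by (simp only: of_nat_sum[symmetric] of_nat_mult[symmetric] of_nat_le_iff)
  also have "\<dots> \<le> (\<Sum>j\<in>S. (exp 1 * w) ^ Suc j * (z ^ Suc j * real (card I choose r)))"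
    using assms
    by (intro sum_mono mult_mono binomial_le_exp_power binomial_diff_le_power) auto
  also have "\<dots> = (\<Sum>j\<in>S. (exp 1 * w * z) ^ Suc j) * real (card I choose r)"
    unfolding sum_distrib_right by (intro sum.cong refl) (simp only: power_mult_distrib mult.assoc)
  finally show ?thesis .
qed

text \<open>The same bound measured against the number of sets through one fixed point, the scale on
  which the excess of a family is compared. Only \<open>j\<close> of the \<open>Suc j\<close>
  prescribed points then yield a factor \<open>z\<close>, hence the division by
  \<open>z\<close>.\<close>

lemma card_crowded_le':
  fixes w z :: real
  assumes "finite I" "finite S" "S \<subseteq> {..<r}" "1 \<le> r" "r \<le> card I"
    and "real (r - 1) \<le> z * real (card I - 1)" "0 < z" "z \<le> 1" "0 \<le> w"
    and T: "\<And>j. j \<in> S \<Longrightarrow> real (card (T j \<inter> I)) \<le> real (Suc j) * w"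
  shows "real (card {B \<in> nsets I r. \<exists>j\<in>S. Suc j \<le> card (B \<inter> T j)})
    \<le> (\<Sum>j\<in>S. (exp 1 * w * z) ^ Suc j) / z * real ((card I - 1) choose (r - 1))"
proof -
  have "real (card {B \<in> nsets I r. \<exists>j\<in>S. Suc j \<le> card (B \<inter> T j)})
      \<le> (\<Sum>j\<in>S. real (card (T j \<inter> I) choose Suc j) * real ((card I - Suc j) choose (r - Suc j)))"
    using card_crowded_le_sum[OF assms(1-3), of T]
    by (simp only: of_nat_sum[symmetric] of_nat_mult[symmetric] of_nat_le_iff)
  also have "\<dots> \<le> (\<Sum>j\<in>S. (exp 1 * w) ^ Suc j * (z ^ j * real ((card I - 1) choose (r - 1))))"
  proof (intro sum_mono mult_mono)
    fix j assume j: "j \<in> S"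
    show "real (card (T j \<inter> I) choose Suc j) \<le> (exp 1 * w) ^ Suc j"
      using T[OF j] assms(9) by (rule binomial_le_exp_power)
    show "real ((card I - Suc j) choose (r - Suc j)) \<le> z ^ j * real ((card I - 1) choose (r - 1))"
      using binomial_diff_le_power[of j "r - 1" "card I - 1" z] assms j by auto
  qed (use assms in auto)
  also have "\<dots> = (\<Sum>j\<in>S. (exp 1 * w * z) ^ Suc j) / z * real ((card I - 1) choose (r - 1))"
    unfolding sum_distrib_right sum_divide_distrib
    using \<open>0 < z\<close> by (intro sum.cong refl) (simp add: power_mult_distrib)
  finally show ?thesis .
qed

lemma sum_power_Suc_tail_le:
  fixes q :: real
  assumes "0 \<le> q" "q < 1"
  shows "(\<Sum>j\<in>{a..<b}. q ^ Suc j) \<le> q ^ Suc a / (1 - q)"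
proof -
  have "(\<Sum>j\<in>{a..<b}. q ^ Suc j) = q * (\<Sum>j\<in>{a..<b}. q ^ j)"
    by (simp add: sum_distrib_left)
  also have "\<dots> \<le> q * (q ^ a / (1 - q))"
    using assms by (intro mult_left_mono sum_power_tail_le) auto
  finally show ?thesis by simp
qed

section \<open>Members with a prescribed minimum\<close>

definition with_min :: "nat \<Rightarrow> nat set set \<Rightarrow> nat set set" where
  "with_min v G = {F \<in> G. v \<in> F \<and> F \<subseteq> {v..}}"

lemma card_with_min_nsets:
  assumes "1 \<le> r" "1 \<le> v" "v \<le> n"
  shows "card (with_min v (nsets {1..n} r)) = (n - v) choose (r - 1)"
proof -
  have "F \<subseteq> {v..n} \<longleftrightarrow> F \<subseteq> {1..n} \<and> F \<subseteq> {v..}" for F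
    using assms by (auto simp: subset_iff)
  then have "with_min v (nsets {1..n} r) = {B \<in> nsets {v..n} r. {v} \<subseteq> B}"
    by (auto simp: with_min_def nsets_def)
  then show ?thesis
    using card_nsets_supersets[of "{v..n}" "{v}" r] assms by simp
qed

text \<open>Exchanging the minimum \<open>v\<close> for \<open>u\<close> is a shift, and it is
  injective.\<close>

lemma card_with_min_antimono:
  assumes "shift_closed G" "G \<subseteq> nsets {1..n} r" "1 \<le> u" "u \<le> v"
  shows "card (with_min v G) \<le> card (with_min u G)"
proof (cases "u = v")
  case False
  have fin: "finite G"
    using assms(2) finite_imp_finite_nsets finite_subset by blast
  have notin: "u \<notin> F" if "F \<in> with_min v G" for F
    using that False \<open>u \<le> v\<close> by (auto simp: with_min_def)
  show ?thesis
  proof (rule card_inj_on_le)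
    show "inj_on (\<lambda>F. insert u (F - {v})) (with_min v G)"
    proof (rule inj_onI)
      fix A B assume AB: "A \<in> with_min v G" "B \<in> with_min v G"
        and eq: "insert u (A - {v}) = insert u (B - {v})"
      have "A - {v} = B - {v}"
        using notin AB eq by (metis DiffD1 insert_ident)
      moreover have "v \<in> A" "v \<in> B" using AB by (auto simp: with_min_def)
      ultimately show "A = B" by blast
    qed
    show "(\<lambda>F. insert u (F - {v})) ` with_min v G \<subseteq> with_min u G"
    proof clarify
      fix F assume F: "F \<in> with_min v G"
      then have "insert u (F - {v}) \<in> G"
        using assms notin[OF F] False unfolding shift_closed_def with_min_def
        by (metis (no_types, lifting) le_neq_implies_less mem_Collect_eq)
      moreover have "insert u (F - {v}) \<subseteq> {u..}"
        using F \<open>u \<le> v\<close> by (auto simp: with_min_def)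
      ultimately show "insert u (F - {v}) \<in> with_min u G"
        by (simp add: with_min_def)
    qed
    show "finite (with_min u G)" using fin by (simp add: with_min_def)
  qed
qed simp

text \<open>From index 1 on the entries are the last points of consecutive blocks of
  \<open>s\<close> points after \<open>J * s\<close>, so they dominate a sequence that takes any one
  residue class in these blocks.\<close>

definition reserved :: "nat \<Rightarrow> nat \<Rightarrow> nat \<Rightarrow> nat \<Rightarrow> nat" where
  "reserved s J v j = (if j = 0 then v else (J + j) * s)"

lemma strict_mono_reserved:
  assumes "1 \<le> s" "v < (J + 1) * s"
  shows "strict_mono (reserved s J v)"
  unfolding strict_mono_Suc_iff using assms by (auto simp: reserved_def)

text \<open>\<open>shift_closed_pattern\<close> must fail at some entry, and not at the first, since
  \<open>v\<close> is the minimum. Deleting \<open>v\<close> then lowers both the index and the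
  count by one.\<close>

lemma card_with_min_le_crowded:
  assumes G: "shift_closed G" "G \<subseteq> nsets {1..n} r" and r: "1 \<le> r"
    and v: "1 \<le> v" "v < s"
    and no: "reserved s J v ` {..<r} \<notin> G"
  shows "card (with_min v G)
    \<le> card {B \<in> nsets {v+1..n} (r - 1). \<exists>j\<in>{..<r - 1}. Suc j \<le> card (B \<inter> {..<(J + j + 1) * s})}"
    (is "_ \<le> card ?C")
proof (rule card_inj_on_le)
  show "inj_on (\<lambda>F. F - {v}) (with_min v G)"
    by (rule inj_onI) (auto simp: with_min_def)
  show "finite ?C" by (simp add: finite_imp_finite_nsets)
  show "(\<lambda>F. F - {v}) ` with_min v G \<subseteq> ?C"
  proof clarify
    fix F assume F: "F \<in> with_min v G"
    then have FG: "F \<in> G" "v \<in> F" "F \<subseteq> {v..}" by (auto simp: with_min_def)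
    have Fn: "F \<subseteq> {1..n}" "finite F" "card F = r" using FG G by (auto simp: nsets_def)
    have sm: "strict_mono (reserved s J v)"
      using v by (intro strict_mono_reserved) auto
    obtain j where j: "j < r" "j < card (F \<inter> {1..<reserved s J v j})"
      using shift_closed_pattern[OF G FG(1) sm] no v by (force simp: reserved_def not_le)
    have "j \<noteq> 0"
    proof
      assume "j = 0"
      moreover have "F \<inter> {1..<v} = {}" using FG by auto
      ultimately show False using j by (simp add: reserved_def)
    qed
    then obtain i where i: "j = Suc i" using not0_implies_Suc by blast
    have "F \<inter> {1..<reserved s J v j} \<subseteq> insert v ((F - {v}) \<inter> {..<(J + i + 1) * s})"
      using i by (auto simp: reserved_def)
    then have "card (F \<inter> {1..<reserved s J v j}) \<le> card (insert v ((F - {v}) \<inter> {..<(J + i + 1) * s}))"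
      using Fn(2) by (intro card_mono) auto
    also have "\<dots> = Suc (card ((F - {v}) \<inter> {..<(J + i + 1) * s}))"
      using Fn(2) by (subst card_insert_disjoint) auto
    finally have "card (F \<inter> {1..<reserved s J v j}) \<le> Suc (card ((F - {v}) \<inter> {..<(J + i + 1) * s}))" .
    then have "Suc i \<le> card ((F - {v}) \<inter> {..<(J + i + 1) * s})"
      using j(2) i by linarith
    moreover have "F - {v} \<in> nsets {v+1..n} (r - 1)"
      using FG Fn by (force simp: nsets_def)
    ultimately show "F - {v} \<in> nsets {v+1..n} (r - 1) \<and>
        (\<exists>j\<in>{..<r - 1}. Suc j \<le> card ((F - {v}) \<inter> {..<(J + j + 1) * s}))"
      using j i by (intro conjI bexI[of _ i]) auto
  qed
qed

text \<open>Uncrowded sets are sought only in \<open>{J * s + 1..n}\<close>. There the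
  \<open>j\<close>-th window has fewer than \<open>(j + 1) * s\<close> points, so the crowded share
  is at most \<open>q + q^2 + ... = q / (1 - q)\<close>.\<close>

lemma card_crowded_beyond_le:
  fixes z q :: real
  assumes "v \<le> J * s" "J * s \<le> n" "r \<le> n - J * s" "real r \<le> z * real (n - J * s)"
    and z: "0 \<le> z" "z \<le> 1" "exp 1 * real s * z \<le> q" "q < 1"
  shows "real (card {B \<in> nsets {v+1..n} r. \<exists>j\<in>{..<r}. Suc j \<le> card (B \<inter> {..<(J + j + 1) * s})})
    \<le> real ((n - v) choose r) - (1 - q / (1 - q)) * real ((n - J * s) choose r)"
proof -
  let ?C = "{B \<in> nsets {v+1..n} r. \<exists>j\<in>{..<r}. Suc j \<le> card (B \<inter> {..<(J + j + 1) * s})}"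
  let ?I = "{J * s + 1..n}"
  let ?T = "\<lambda>j. {..<(J + j + 1) * s}"
  let ?D = "{B \<in> nsets ?I r. \<exists>j\<in>{..<r}. Suc j \<le> card (B \<inter> ?T j)}"
  have q0: "0 \<le> q" using z by (meson exp_ge_zero mult_nonneg_nonneg of_nat_0_le_iff order_trans)
  have "real (card ?D) \<le> (\<Sum>j\<in>{..<r}. (exp 1 * real s * z) ^ Suc j) * real (card ?I choose r)"
  proof (rule card_crowded_le)
    fix j assume "j \<in> {..<r}"
    have "?T j \<inter> ?I \<subseteq> {J * s + 1..<(J + j + 1) * s}" by auto
    then have "card (?T j \<inter> ?I) \<le> card {J * s + 1..<(J + j + 1) * s}"
      by (intro card_mono) auto
    also have "\<dots> \<le> Suc j * s"
      by (simp add: algebra_simps)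
    finally show "real (card (?T j \<inter> ?I)) \<le> real (Suc j) * real s"
      by (simp only: of_nat_mult[symmetric] of_nat_le_iff)
  qed (use assms in auto)
  also have "\<dots> \<le> (q / (1 - q)) * real (card ?I choose r)"
  proof (rule mult_right_mono)
    have "(\<Sum>j\<in>{..<r}. (exp 1 * real s * z) ^ Suc j) \<le> (\<Sum>j\<in>{0..<r}. q ^ Suc j)"
      using z by (simp only: lessThan_atLeast0) (intro sum_mono power_mono, auto)
    also have "\<dots> \<le> q ^ Suc 0 / (1 - q)"
      using q0 z by (intro sum_power_Suc_tail_le)
    finally show "(\<Sum>j\<in>{..<r}. (exp 1 * real s * z) ^ Suc j) \<le> q / (1 - q)" by simp
  qed simp
  finally have D: "real (card ?D) \<le> (q / (1 - q)) * real ((n - J * s) choose r)" by simp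
  have sub: "nsets ?I r \<subseteq> nsets {v+1..n} r"
    using assms by (intro nsets_mono) auto
  have "?C \<subseteq> nsets {v+1..n} r - (nsets ?I r - ?D)" by auto
  then have "card ?C \<le> card (nsets {v+1..n} r - (nsets ?I r - ?D))"
    by (intro card_mono) (simp_all add: finite_imp_finite_nsets)
  also have "\<dots> = card (nsets {v+1..n} r) - (card (nsets ?I r) - card ?D)"
  proof (subst card_Diff_subset)
    show "card (nsets {v+1..n} r) - card (nsets ?I r - ?D) = card (nsets {v+1..n} r) - (card (nsets ?I r) - card ?D)"
      by (subst card_Diff_subset) (auto simp: finite_imp_finite_nsets)
  qed (use sub in \<open>auto simp: finite_imp_finite_nsets\<close>)
  finally have "card ?C + (card (nsets ?I r) - card ?D) \<le> card (nsets {v+1..n} r)"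
    using card_mono[OF _ sub] by (simp add: finite_imp_finite_nsets)
  then have "real (card ?C) + real ((n - J * s) choose r) - real (card ?D) \<le> real ((n - v) choose r)"
    by (simp add: card_nsets)
  then show ?thesis using D by (simp add: algebra_simps)
qed

section \<open>Sequences to be prescribed\<close>

lemma exp_1_le: "exp 1 \<le> (272/100 :: real)"
  using e_less_272 by simp

text \<open>Serves for crowding within the rows of \<open>d\<close> elements, where \<open>x\<close>
  is the density, \<open>L\<close> is \<open>2 + ln s\<close> and the series starts with the square.
  The logarithm in the bound on \<open>n\<close> enters through
  \<open>s * x * L \<le> 1/12\<close>.\<close>

lemma early_terms_le:
  fixes s x L d J :: real
  assumes s: "2 \<le> s" and L: "2 \<le> L" "L \<le> s + 1" and x: "0 < x" "s * x * L \<le> 1/12"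
    and d: "1 \<le> d" "d \<le> s - 1" and J: "1 \<le> J" "J \<le> L"
  defines "A \<equiv> exp 1 * (d + (J - 1) / 2) * x"
  shows "A < 1" "A^2 / (1 - A) / x \<le> 56/100 * d"
proof -
  define w where "w = d + (J - 1) / 2"
  have w0: "1 \<le> w" unfolding w_def diff_divide_distrib using d J by linarith
  have sL0: "0 \<le> s * L" using s L by simp
  \<comment> \<open>Equivalent to \<open>(s - 2) * (L - 2) \<ge> 0\<close>.\<close>
  have sL: "s + L - 2 \<le> s * L / 2"
    using mult_nonneg_nonneg[of "s - 2" "L - 2"] s L by (simp add: algebra_simps)
  have "w \<le> (s - 1) + (L - 1) / 2"
    unfolding w_def diff_divide_distrib using d J by linarith
  also have "\<dots> \<le> 3/4 * (s * L)"
    unfolding diff_divide_distrib using sL sL0 L by linarith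
  finally have w1: "w \<le> 3/4 * (s * L)" .
  have "(L - 1)\<^sup>2 \<le> s * (L - 1)"
    unfolding power2_eq_square using L by (intro mult_right_mono) auto
  then have "(L - 1)\<^sup>2 / 4 \<le> s * L / 4"
    unfolding right_diff_distrib using s by linarith
  then have B: "d + (L - 1) + (L - 1)\<^sup>2 / 4 \<le> 3/4 * (s * L)"
    using sL d by linarith
  have "w\<^sup>2 \<le> (d + (L - 1) / 2)\<^sup>2"
    using w0 J d by (intro power_mono) (auto simp: w_def)
  also have "\<dots> = d * (d + (L - 1)) + (L - 1)\<^sup>2 / 4"
    by (simp add: power2_eq_square field_simps)
  \<comment> \<open>As \<open>d \<ge> 1\<close>, a factor \<open>d\<close> can be put on the last
    summand, which makes the final bound linear in \<open>d\<close>.\<close>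
  also have "\<dots> \<le> d * (d + (L - 1)) + d * ((L - 1)\<^sup>2 / 4)"
    using d by (simp add: mult_le_cancel_right1)
  also have "\<dots> = d * (d + (L - 1) + (L - 1)\<^sup>2 / 4)"
    by (simp add: algebra_simps)
  also have "\<dots> \<le> d * (3/4 * (s * L))"
    using B d by (intro mult_left_mono) auto
  finally have w2: "w\<^sup>2 \<le> d * (3/4 * (s * L))" .
  have "w * x \<le> 3/4 * (s * L) * x"
    using w1 x by (intro mult_right_mono) auto
  also have "\<dots> \<le> 1/16" using x by (simp add: mult_ac)
  finally have wx: "w * x \<le> 1/16" .
  have A: "A = exp 1 * (w * x)" by (simp add: A_def w_def mult_ac)
  have "A \<le> 272/100 * (1/16)"
    unfolding A using wx w0 x exp_1_le by (intro mult_mono) auto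
  then have A1: "A \<le> 17/100" by simp
  then show "A < 1" by simp
  have "w\<^sup>2 * x \<le> d * (3/4 * (s * L)) * x"
    using w2 x by (intro mult_right_mono) auto
  also have "\<dots> = d * (3/4) * (s * x * L)" by simp
  also have "\<dots> \<le> d * (3/4) * (1/12)"
    using x d by (intro mult_left_mono) auto
  finally have w2x: "w\<^sup>2 * x \<le> d / 16" by simp
  have e2: "(exp 1)\<^sup>2 \<le> (272/100 :: real)\<^sup>2"
    using exp_1_le by (intro power_mono) auto
  have "A\<^sup>2 / x = (exp 1)\<^sup>2 * (w\<^sup>2 * x)"
    using x by (simp add: A power2_eq_square field_simps)
  also have "\<dots> \<le> (272/100)\<^sup>2 * (d / 16)"
    using e2 w2x x by (intro mult_mono) auto
  finally have A2: "A\<^sup>2 / x \<le> (272/100)\<^sup>2 * (d / 16)" .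
  have "A\<^sup>2 / (1 - A) / x = A\<^sup>2 / x / (1 - A)" by simp
  also have "\<dots> \<le> A\<^sup>2 / x / (83/100)"
    using A1 x by (intro divide_left_mono) auto
  also have "\<dots> \<le> (272/100)\<^sup>2 * (d / 16) / (83/100)"
    using A2 by (intro divide_right_mono) auto
  also have "\<dots> \<le> 56/100 * d" using d by (simp add: power2_eq_square)
  finally show "A^2 / (1 - A) / x \<le> 56/100 * d" .
qed

text \<open>This is why \<open>J\<close> has to be about \<open>ln s\<close>: dividing by
  \<open>x\<close> leaves a factor \<open>A / x = exp 1 * s\<close>, which \<open>exp 1 ^ J\<close>
  absorbs. The remaining ratio \<open>exp 1 * A\<close> is below \<open>31/100\<close>.\<close>

lemma late_terms_le:
  fixes s x :: real
  assumes s: "0 < s" "s \<le> exp (real J - 1)" and x: "0 < x" "s * x \<le> 1/24"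
  defines "A \<equiv> exp 1 * s * x"
  shows "A \<le> 1/8" "A ^ Suc J / (1 - A) / x \<le> (8/7) * (31/100) ^ J"
proof -
  have A: "A = exp 1 * (s * x)" by (simp add: A_def)
  have sx: "0 < s * x" using s x by simp
  have "A \<le> 272/100 * (1/24)"
    unfolding A using x sx exp_1_le by (intro mult_mono) auto
  then have A1: "A \<le> 272/2400" by simp
  then show A18: "A \<le> 1/8" by simp
  have A0: "0 < A" using sx by (simp add: A)
  have "exp 1 * s \<le> exp 1 * exp (real J - 1)"
    using s by simp
  also have "\<dots> = exp 1 ^ J"
    by (simp add: exp_add[symmetric] exp_of_nat_mult[symmetric])
  finally have es: "exp 1 * s \<le> exp 1 ^ J" .
  have "A ^ Suc J / (1 - A) / x = (exp 1 * s) * A ^ J / (1 - A)"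
    using x by (simp add: A_def)
  also have "\<dots> \<le> (exp 1 ^ J) * A ^ J / (1 - A)"
    using es A0 A18 by (intro divide_right_mono mult_right_mono) auto
  also have "\<dots> = (exp 1 * A) ^ J / (1 - A)" by (simp add: power_mult_distrib)
  also have "\<dots> \<le> (31/100) ^ J / (7/8)"
  proof (rule frac_le)
    have "exp 1 * A \<le> 272/100 * (272/2400)"
      using exp_1_le A1 A0 by (intro mult_mono) auto
    then show "(exp 1 * A) ^ J \<le> (31/100) ^ J"
      using A0 by (intro power_mono) auto
  qed (use A18 in auto)
  finally show "A ^ Suc J / (1 - A) / x \<le> (8/7) * (31/100) ^ J" by simp
qed

text \<open>After the consecutive start the entries are again last points of blocks of
  \<open>s\<close> points, the first of these blocks beginning at \<open>J * s + 1\<close>.\<close>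

definition head :: "nat \<Rightarrow> nat \<Rightarrow> nat \<Rightarrow> nat" where
  "head s J j = (if j < J then s + j else (j + 1) * s)"

lemma strict_mono_head: "2 \<le> s \<Longrightarrow> strict_mono (head s J)"
  unfolding strict_mono_Suc_iff
proof
  fix j assume s: "2 \<le> s"
  have "(j + 1) * 1 \<le> (j + 1) * s" using s by (intro mult_le_mono2) simp
  then have "j < (j + 1) * s" by simp
  moreover have "(j + 1) * s < (Suc j + 1) * s" using s by simp
  ultimately show "head s J j < head s J (Suc j)"
    unfolding head_def by (simp split: if_splits)
qed

lemma card_nsets_diff_initial:
  assumes "1 \<le> u" "u \<le> n"
  shows "card (nsets {1..n} r - nsets {u..n} r) = (n choose r) - ((n - u + 1) choose r)"
proof -
  have "nsets {u..n} r \<subseteq> nsets {1..n} r"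
    using assms by (intro nsets_mono) auto
  then have "card (nsets {1..n} r - nsets {u..n} r) = card (nsets {1..n} r) - card (nsets {u..n} r)"
    by (intro card_Diff_subset) (simp_all add: finite_imp_finite_nsets)
  then show ?thesis
    using assms by (simp add: card_nsets Suc_diff_le)
qed

text \<open>The bound is exactly the number of \<open>r\<close>-sets that meet
  \<open>{1..<s}\<close>.\<close>

lemma ex_member_beyond:
  assumes "G \<subseteq> nsets {1..n} r" "1 \<le> s" "s \<le> n" "(n choose r) - ((n - s + 1) choose r) < card G"
  shows "\<exists>F\<in>G. F \<subseteq> {s..n}"
proof (rule ccontr)
  assume "\<not> ?thesis"
  then have "G \<subseteq> nsets {1..n} r - nsets {s..n} r"
    using assms(1) by (auto simp: nsets_def)
  then have "card G \<le> card (nsets {1..n} r - nsets {s..n} r)"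
    by (intro card_mono) (auto simp: finite_imp_finite_nsets)
  then show False using assms card_nsets_diff_initial[of s n r] by simp
qed

text \<open>For \<open>r \<le> J\<close> only the consecutive start matters, and it is the lowest
  \<open>r\<close>-set within \<open>{s..n}\<close>. This guarantees that a suitable
  \<open>J\<close> exists at all.\<close>

lemma head_mem:
  assumes "shift_closed G" "G \<subseteq> nsets {1..n} r" "2 \<le> s" "s \<le> n" "r \<le> J"
    and "(n choose r) - ((n - s + 1) choose r) < card G"
  shows "head s J ` {..<r} \<in> G"
proof -
  obtain F where F: "F \<in> G" "F \<subseteq> {s..n}"
    using ex_member_beyond[of G n r s] assms by auto
  show ?thesis
  proof (rule shift_closed_pattern[OF assms(1,2) F(1)])
    fix j assume "j < r"
    then have "F \<inter> {1..<head s J j} \<subseteq> {s..<s + j}"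
      using F assms by (auto simp: head_def)
    then have "card (F \<inter> {1..<head s J j}) \<le> card {s..<s + j}"
      by (intro card_mono) auto
    then show "card (F \<inter> {1..<head s J j}) \<le> j" by simp
  qed (use assms strict_mono_head in \<open>auto simp: head_def\<close>)
qed

text \<open>Inside \<open>{s..n}\<close> only \<open>j\<close> points lie below
  \<open>s + j\<close>, so a missing \<open>head\<close> sequence forces crowding at an index
  \<open>j \<ge> J\<close>, and the series starts at exponent \<open>Suc J\<close>.\<close>

lemma card_beyond_le:
  fixes x :: real
  assumes G: "shift_closed G" "G \<subseteq> nsets {1..n} r" and s: "2 \<le> s" "s \<le> n" and r: "1 \<le> r" "r \<le> n - s"
    and x: "real (r - 1) \<le> x * real (n - s)" "0 < x" "x \<le> 1" "exp 1 * real s * x < 1"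
    and no: "head s J ` {..<r} \<notin> G"
  shows "real (card (G \<inter> nsets {s..n} r))
    \<le> (exp 1 * real s * x) ^ Suc J / (1 - exp 1 * real s * x) / x * real ((n - s) choose (r - 1))"
proof -
  let ?T = "\<lambda>j. {..<(j + 1) * s}"
  have "G \<inter> nsets {s..n} r \<subseteq> {B \<in> nsets {s..n} r. \<exists>j\<in>{J..<r}. Suc j \<le> card (B \<inter> ?T j)}"
  proof clarify
    fix F assume F: "F \<in> G" "F \<in> nsets {s..n} r"
    have sm: "strict_mono (head s J)" using s strict_mono_head by auto
    have h0: "1 \<le> head s J 0" using s by (simp add: head_def)
    obtain j where j: "j < r" "j < card (F \<inter> {1..<head s J j})"
      using shift_closed_pattern[OF G F(1) sm h0] no not_le by blast
    have "\<not> j < J"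
    proof
      assume "j < J"
      then have "F \<inter> {1..<head s J j} \<subseteq> {s..<s + j}"
        using F(2) by (auto simp: head_def nsets_def)
      then have "card (F \<inter> {1..<head s J j}) \<le> card {s..<s + j}"
        by (intro card_mono) auto
      then show False using j by simp
    qed
    moreover have "card (F \<inter> {1..<head s J j}) \<le> card (F \<inter> ?T j)"
      using \<open>\<not> j < J\<close> F by (intro card_mono) (auto simp: head_def nsets_def)
    ultimately show "\<exists>j\<in>{J..<r}. Suc j \<le> card (F \<inter> ?T j)"
      using j by (intro bexI[of _ j]) auto
  qed
  then have "card (G \<inter> nsets {s..n} r) \<le> card {B \<in> nsets {s..n} r. \<exists>j\<in>{J..<r}. Suc j \<le> card (B \<inter> ?T j)}"
    by (intro card_mono) (auto simp: finite_imp_finite_nsets)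
  then have "real (card (G \<inter> nsets {s..n} r))
      \<le> real (card {B \<in> nsets {s..n} r. \<exists>j\<in>{J..<r}. Suc j \<le> card (B \<inter> ?T j)})"
    by (simp only: of_nat_le_iff)
  also have "\<dots> \<le> (\<Sum>j\<in>{J..<r}. (exp 1 * real s * x) ^ Suc j) / x
      * real ((card {s..n} - 1) choose (r - 1))"
  proof (rule card_crowded_le')
    fix j
    have "?T j \<inter> {s..n} \<subseteq> {s..<(j + 1) * s}" by auto
    then have "card (?T j \<inter> {s..n}) \<le> card {s..<(j + 1) * s}"
      by (intro card_mono) auto
    also have "\<dots> \<le> Suc j * s" by simp
    finally show "real (card (?T j \<inter> {s..n})) \<le> real (Suc j) * real s"
      by (simp only: of_nat_mult[symmetric] of_nat_le_iff)
  qed (use assms in auto)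
  also have "\<dots> \<le> (exp 1 * real s * x) ^ Suc J / (1 - exp 1 * real s * x) / x
      * real ((card {s..n} - 1) choose (r - 1))"
    using x by (intro mult_right_mono divide_right_mono sum_power_Suc_tail_le) auto
  finally show ?thesis using s by simp
qed

text \<open>Deleting the points in \<open>J\<close> batches of size \<open>t\<close> gives a product
  that stays useful when \<open>J * t * z\<close> exceeds 1. The ratio bound after the last batch
  covers all earlier ones.\<close>

lemma binomial_sub_ge_power:
  fixes z :: real
  assumes "J * t + r \<le> p" "real r \<le> z * real (p - J * t)" "0 \<le> z" "real t * z \<le> 1"
  shows "(1 - real t * z) ^ J * real (p choose r) \<le> real ((p - J * t) choose r)"
  using assms(1,2)
proof (induction J)
  case (Suc J)
  have le: "z * real (p - Suc J * t) \<le> z * real (p - J * t)"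
    using assms by (intro mult_left_mono) auto
  have "(1 - real t * z) ^ Suc J * real (p choose r)
      = (1 - real t * z) * ((1 - real t * z) ^ J * real (p choose r))" by simp
  also have "\<dots> \<le> (1 - real t * z) * real ((p - J * t) choose r)"
    using Suc le assms by (intro mult_left_mono Suc.IH) auto
  also have "\<dots> \<le> real ((p - J * t - t) choose r)"
    using Suc.prems le by (intro binomial_sub_ge) auto
  finally show ?case by (simp add: algebra_simps)
qed simp

text \<open>Shrinking the ground set by \<open>u\<close> costs \<open>k * u / n \<le> 1\<close>,
  which the 1 in \<open>r - 1\<close> pays for.\<close>

lemma ratio_le:
  assumes "1 \<le> n" "r \<le> k" "k * u \<le> n" "1 \<le> r" "1 \<le> k"
  shows "real (r - 1) \<le> real k / real n * real (n - u)"
proof -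
  have "u \<le> n" using assms(3,5) by (metis le_trans mult_le_mono1 nat_mult_1)
  have "real k * real u \<le> real n"
    using assms(3) by (simp only: of_nat_mult[symmetric] of_nat_le_iff)
  then have "real k / real n * real (n - u) \<ge> real k - 1"
    using assms(1) \<open>u \<le> n\<close> by (simp add: field_simps of_nat_diff)
  moreover have "real (r - 1) \<le> real k - 1"
    using assms by (simp add: of_nat_diff)
  ultimately show ?thesis by simp
qed

section \<open>Families above the bound\<close>

text \<open>For the \<open>i\<close>-th of \<open>d\<close> leftover families: the first entry is
  one of the free points \<open>m + 1, ..., m + d\<close>, then come interleaved rows of
  \<open>d\<close> points after the start \<open>s, ..., s + J - 1\<close> of a \<open>head\<close>
  sequence, then block ends.\<close>

definition late :: "nat \<Rightarrow> nat \<Rightarrow> nat \<Rightarrow> nat \<Rightarrow> nat \<Rightarrow> nat \<Rightarrow> nat" where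
  "late s J m d i j =
     (if j = 0 then m + 1 + i else if j < J then s + J + (j - 1) * d + i else (j + 1) * s)"

lemma strict_mono_late:
  assumes "2 \<le> s" "1 \<le> J" "1 \<le> d" "m + d + 1 = s" "i < d"
  shows "strict_mono (late s J m d i)"
  unfolding strict_mono_Suc_iff
proof
  fix j
  consider "j = 0" "J = 1" | "j = 0" "1 < J" | "0 < j" "Suc j < J" | "0 < j" "Suc j = J" | "0 < j" "J \<le> j"
    using assms(2) by linarith
  then show "late s J m d i j < late s J m d i (Suc j)"
  proof cases
    case 3
    then obtain l where "j = Suc l" using gr0_conv_Suc by auto
    then show ?thesis using 3 assms by (simp add: late_def)
  next
    case 4
    then obtain l where l: "j = Suc l" using gr0_conv_Suc by auto
    have "l * (d + 1) \<le> l * s" using assms by (intro mult_le_mono2) simp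
    then have "s + (l + 2) + l * d + i < (l + 3) * s"
      using assms by (simp add: algebra_simps)
    then show ?thesis using 4 l by (auto simp: late_def algebra_simps)
  qed (use assms in \<open>auto simp: late_def\<close>)
qed

section \<open>Consequences of the lower bound on \<open>n\<close>\<close>

locale large_ground_set =
  fixes n k s :: nat
  assumes s2: "2 \<le> s" and k1: "1 \<le> k"
    and n_ge: "12 * real k * real s * (2 + ln (real s)) \<le> real n"
begin

definition "dens = real k / real n"

lemma ln_s: "0 < ln (real s)" "ln (real s) \<le> real s - 1"
  using s2 ln_le_minus_one[of "real s"] by auto

lemma n_pos: "0 < n"
proof -
  have "0 < 12 * real k * real s * (2 + ln (real s))"
    using s2 k1 ln_s by (intro mult_pos_pos) auto
  then show ?thesis using n_ge by linarith
qed

lemma dens_pos: "0 < dens"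
  using n_pos k1 by (simp add: dens_def)

lemma s_dens_ln: "real s * dens * (2 + ln (real s)) \<le> 1/12"
  using n_ge n_pos by (simp add: dens_def field_simps)

lemma s_dens_le: "real s * dens \<le> 1/24"
proof -
  have "real s * dens * 2 \<le> real s * dens * (2 + ln (real s))"
    using dens_pos ln_s by (intro mult_left_mono) auto
  then show ?thesis using s_dens_ln by simp
qed

lemma dens_le: "dens \<le> 1/48"
proof -
  have "2 * dens \<le> real s * dens" using s2 dens_pos by (intro mult_right_mono) auto
  then show ?thesis using s_dens_le by simp
qed

lemma n_ge_24: "24 * k * s \<le> n"
proof -
  have "real (24 * k * s) \<le> real n"
    using s_dens_le n_pos by (simp add: dens_def field_simps)
  then show ?thesis by (simp only: of_nat_le_iff)
qed

lemma s_le_n: "s \<le> n"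
proof -
  have "1 * s \<le> 24 * k * s" using k1 by (intro mult_le_mono1) simp
  then show ?thesis using n_ge_24 by linarith
qed

text \<open>At least \<open>6/7\<close> of the sets beyond \<open>J * s\<close> are uncrowded, and
  these make up at least \<open>11/12\<close> of all candidates. So \<open>11/14\<close> of the
  candidates are missing.\<close>

lemma card_with_min_le:
  assumes G: "shift_closed G" "G \<subseteq> nsets {1..n} r" and r: "1 \<le> r" "r \<le> k"
    and v: "1 \<le> v" "v < s" and J: "1 \<le> J" "real J \<le> 2 + ln (real s)"
    and no: "reserved s J v ` {..<r} \<notin> G"
  shows "real (card (with_min v G)) \<le> 3/14 * real ((n - v) choose (r - 1))"
proof -
  have "real (12 * k * (J * s)) \<le> real n"
  proof -
    have "12 * real k * real s * real J \<le> 12 * real k * real s * (2 + ln (real s))"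
      using J by (intro mult_left_mono) auto
    then show ?thesis using n_ge by (simp add: mult_ac)
  qed
  then have kJs: "12 * k * (J * s) \<le> n" by (simp only: of_nat_le_iff)
  have Js: "v \<le> J * s" using v J by (metis less_imp_le_nat le_trans mult_le_mono1 nat_mult_1)
  have r_le: "real (r - 1) \<le> dens * real (n - u)" if "k * u \<le> n" for u
    unfolding dens_def using n_pos r k1 that by (intro ratio_le) auto
  have k_le: "k * 1 \<le> k * (J * s)" using Js v by (intro mult_le_mono2) linarith
  have Js_le: "1 * (J * s) \<le> k * (J * s)" using k1 by (intro mult_le_mono1)
  have JsN: "J * s \<le> n" "r - 1 \<le> n - J * s"
    using kJs k_le Js_le r by linarith+
  have "card (with_min v G)
      \<le> card {B \<in> nsets {v+1..n} (r - 1). \<exists>j\<in>{..<r - 1}. Suc j \<le> card (B \<inter> {..<(J + j + 1) * s})}"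
    using G r v no by (intro card_with_min_le_crowded) auto
  also have "real \<dots> \<le> real ((n - v) choose (r - 1))
      - (1 - (1/8) / (1 - 1/8)) * real ((n - J * s) choose (r - 1))"
  proof (rule card_crowded_beyond_le)
    show "real (r - 1) \<le> dens * real (n - J * s)"
      using kJs by (intro r_le) simp
    have "exp 1 * (real s * dens) \<le> 272/100 * (1/24)"
      using exp_1_le s_dens_le dens_pos by (intro mult_mono) auto
    then show "exp 1 * real s * dens \<le> 1/8" by (simp add: mult_ac)
  qed (use Js JsN dens_pos dens_le in auto)
  finally have 1: "real (card (with_min v G))
      \<le> real ((n - v) choose (r - 1)) - 6/7 * real ((n - J * s) choose (r - 1))"
    by simp
  have kv: "k * v \<le> n"
    using mult_le_mono2[OF Js, of k] kJs by linarith
  have "real (J * s - v) * dens \<le> 1/12"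
  proof -
    have "real (J * s - v) * dens \<le> real (J * s) * dens"
      using dens_pos by (intro mult_right_mono of_nat_mono) auto
    also have "\<dots> = real J * (real s * dens)" by simp
    also have "\<dots> \<le> (2 + ln (real s)) * (real s * dens)"
      using J dens_pos by (intro mult_right_mono) auto
    also have "\<dots> = real s * dens * (2 + ln (real s))" by simp
    also note s_dens_ln
    finally show ?thesis .
  qed
  then have "11/12 * real ((n - v) choose (r - 1)) \<le> (1 - real (J * s - v) * dens) * real ((n - v) choose (r - 1))"
    by (intro mult_right_mono) auto
  also have "\<dots> \<le> real ((n - v - (J * s - v)) choose (r - 1))"
  proof (rule binomial_sub_ge)
    show "J * s - v + (r - 1) \<le> n - v"
      using Js kJs k_le Js_le r by linarith
  qed (rule r_le[OF kv])
  also have "n - v - (J * s - v) = n - J * s" using Js by simp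
  finally show ?thesis using 1 by simp
qed

text \<open>Weighs the sets missing at minimum \<open>v\<close> against the members inside
  \<open>{s..n}\<close>: a family above the bound must have more of the latter.\<close>

lemma card_le_by_min:
  assumes "G \<subseteq> nsets {1..n} r" "1 \<le> r" "1 \<le> v" "v < s"
  shows "real (card G) \<le> real (n choose r) - real ((n - s + 1) choose r)
    - real ((n - v) choose (r - 1)) + real (card (with_min v G)) + real (card (G \<inter> nsets {s..n} r))"
proof -
  let ?N = "nsets {1..n} r" and ?S = "nsets {s..n} r"
  note sn = s_le_n
  have fin: "finite ?N" "finite ?S" "finite G"
    using assms(1) by (auto simp: finite_imp_finite_nsets intro: finite_subset)
  have sub: "with_min v ?N \<subseteq> ?N - ?S"
    using assms(4) by (auto simp: with_min_def nsets_def)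
  have "G \<subseteq> ((?N - ?S) - with_min v ?N) \<union> with_min v G \<union> (G \<inter> ?S)"
    using assms(1) by (auto simp: with_min_def)
  then have "card G \<le> card (((?N - ?S) - with_min v ?N) \<union> with_min v G \<union> (G \<inter> ?S))"
    using fin by (intro card_mono) (auto simp: with_min_def)
  also have "\<dots> \<le> card ((?N - ?S) - with_min v ?N) + card (with_min v G) + card (G \<inter> ?S)"
    by (meson card_Un_le add_le_mono1 le_trans)
  also have "card ((?N - ?S) - with_min v ?N) = card (?N - ?S) - card (with_min v ?N)"
    using sub fin by (intro card_Diff_subset) (auto simp: with_min_def)
  finally have le: "real (card G) \<le> real (card (?N - ?S)) - real (card (with_min v ?N))
      + real (card (with_min v G)) + real (card (G \<inter> ?S))"
    using card_mono[OF _ sub] fin by simp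
  have "card (?N - ?S) = (n choose r) - ((n - s + 1) choose r)"
    using s2 sn by (intro card_nsets_diff_initial) auto
  moreover have "(n - s + 1) choose r \<le> n choose r"
    using s2 sn by (intro binomial_right_mono) auto
  moreover have "card (with_min v ?N) = (n - v) choose (r - 1)"
    using assms sn by (intro card_with_min_nsets) auto
  ultimately show ?thesis using le by simp
qed

text \<open>Without the \<open>head\<close> sequence few members lie in \<open>{s..n}\<close>, so
  few sets with minimum \<open>v\<close> may be missing; but without the \<open>reserved\<close>
  sequence many are. As \<open>M\<close> can be far larger than \<open>ln s\<close>, both sides are
  compared as powers, \<open>31/100\<close> against \<open>22/23\<close>.\<close>

lemma reserved_mem:
  assumes G: "shift_closed G" "G \<subseteq> nsets {1..n} r" and r: "1 \<le> r" "r \<le> k"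
    and big: "(n choose r) - ((n - s + 1) choose r) < card G"
    and M: "2 \<le> M" "real s \<le> exp (real M - 1)" "M + 1 \<le> k" and no: "head s M ` {..<r} \<notin> G"
    and v: "1 \<le> v" "v < s"
  shows "reserved s (M + 1) v ` {..<r} \<in> G"
proof (rule ccontr)
  assume notin: "reserved s (M + 1) v ` {..<r} \<notin> G"
  define J where "J = M + 1"
  \<comment> \<open>Since \<open>J \<le> k\<close>, the points up to \<open>J * s\<close> are at
    most a 24th of \<open>n\<close>; the factor \<open>24/23\<close> compensates for deleting
    them.\<close>
  define z where "z = 24/23 * dens"
  have z: "0 < z" "z \<le> 1" using dens_pos dens_le by (auto simp: z_def)
  have ks: "24 * (k * s) \<le> n" using n_ge_24 by simp
  have Jks: "J * s \<le> k * s" using M by (intro mult_le_mono1) (simp add: J_def)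
  have kks: "k * 1 \<le> k * s" using s2 by (intro mult_le_mono2) simp
  have sks: "1 * s \<le> k * s" using k1 by (intro mult_le_mono1)
  have Js: "v \<le> J * s" using v M by (simp add: J_def)
  have sz: "real s * z \<le> 1/23" using s_dens_le by (simp add: z_def)
  have "exp 1 * (real s * z) \<le> 272/100 * (1/23)"
    using exp_1_le sz z by (intro mult_mono) auto
  then have esz: "exp 1 * real s * z \<le> 1/8" by (simp add: mult_ac)
  have rz: "real (r - 1) \<le> z * real (n - J * s)"
  proof -
    have "real (24 * (J * s)) \<le> real n"
      using Jks ks by (intro of_nat_mono) linarith
    then have "real (J * s) \<le> real n / 24" by simp
    moreover have "J * s \<le> n" using Jks ks by linarith
    ultimately have "23/24 * real n \<le> real (n - J * s)" by (simp add: of_nat_diff)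
    then have "z * (23/24 * real n) \<le> z * real (n - J * s)"
      using z by (intro mult_left_mono) auto
    moreover have "z * (23/24 * real n) = real k" using n_pos by (simp add: z_def dens_def)
    moreover have "real (r - 1) \<le> real k" using r by simp
    ultimately show ?thesis by linarith
  qed
  have JsN: "J * s \<le> n" "r - 1 \<le> n - J * s" "J * s + (r - 1) \<le> n"
    using Jks kks ks r by linarith+
  have "card (with_min v G)
      \<le> card {B \<in> nsets {v+1..n} (r - 1). \<exists>j\<in>{..<r - 1}. Suc j \<le> card (B \<inter> {..<(J + j + 1) * s})}"
    using G r v notin unfolding J_def by (intro card_with_min_le_crowded) auto
  also have "real \<dots> \<le> real ((n - v) choose (r - 1))
      - (1 - (1/8) / (1 - 1/8)) * real ((n - J * s) choose (r - 1))"
    using Js JsN z rz esz by (intro card_crowded_beyond_le[where z = z]) auto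
  finally have 1: "real (card (with_min v G))
      \<le> real ((n - v) choose (r - 1)) - 6/7 * real ((n - J * s) choose (r - 1))"
    by simp
  let ?A = "exp 1 * real s * dens"
  have A: "?A \<le> 1/8" "?A ^ Suc M / (1 - ?A) / dens \<le> (8/7) * (31/100) ^ M"
    using late_terms_le[of "real s" M dens] s2 M dens_pos s_dens_le by auto
  have "real (card (G \<inter> nsets {s..n} r)) \<le> ?A ^ Suc M / (1 - ?A) / dens * real ((n - s) choose (r - 1))"
  proof (rule card_beyond_le[OF G s2 _ r(1) _ _ _ _ _ no])
    show "real (r - 1) \<le> dens * real (n - s)"
      unfolding dens_def using n_pos r k1 ks by (intro ratio_le) auto
    show "s \<le> n" "r \<le> n - s" using ks kks sks r by linarith+
  qed (use dens_pos dens_le A in auto)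
  also have "\<dots> \<le> (8/7) * (31/100) ^ M * real (n choose (r - 1))"
    using A by (intro mult_mono) (auto intro: binomial_right_mono)
  finally have 2: "real (card (G \<inter> nsets {s..n} r)) \<le> (8/7) * (31/100) ^ M * real (n choose (r - 1))" .
  have "(22/23) ^ J * real (n choose (r - 1)) \<le> (1 - real s * z) ^ J * real (n choose (r - 1))"
    using sz by (intro mult_right_mono power_mono) auto
  also have "\<dots> \<le> real ((n - J * s) choose (r - 1))"
    using JsN rz z sz by (intro binomial_sub_ge_power) auto
  finally have 3: "(22/23) ^ J * real (n choose (r - 1)) \<le> real ((n - J * s) choose (r - 1))" .
  have "real ((n choose r) - ((n - s + 1) choose r)) < real (card G)"
    using big by simp
  moreover have "real (card G) \<le> real (n choose r) - real ((n - s + 1) choose r)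
    - real ((n - v) choose (r - 1)) + real (card (with_min v G)) + real (card (G \<inter> nsets {s..n} r))"
    using G r v by (intro card_le_by_min) auto
  moreover have "real (n choose r) - real ((n - s + 1) choose r) \<le> real ((n choose r) - ((n - s + 1) choose r))"
    by linarith
  ultimately have "6/7 * real ((n - J * s) choose (r - 1)) < (8/7) * (31/100) ^ M * real (n choose (r - 1))"
    using 1 2 by linarith
  then have "6/7 * (22/23) ^ J * real (n choose (r - 1)) < (8/7) * (31/100) ^ M * real (n choose (r - 1))"
    using 3 by linarith
  then have "6/7 * (22/23) ^ J < (8/7) * (31/100 :: real) ^ M"
    by (rule mult_right_less_imp_less) simp
  moreover have "(8/7) * (31/100 :: real) ^ M \<le> 6/7 * (22/23) ^ J"
    unfolding J_def using M(1)
  proof (induction rule: dec_induct)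
    case (step m)
    have "8/7 * (31/100 :: real) ^ Suc m = 31/100 * (8/7 * (31/100) ^ m)" by simp
    also have "\<dots> \<le> 22/23 * (6/7 * (22/23) ^ (m + 1))"
      using step.IH by (rule mult_mono[rotated]) auto
    finally show ?case by simp
  qed (simp add: power_numeral_reduce)
  ultimately show False by linarith
qed

text \<open>If the sequence were missing, every member would meet \<open>{1..m}\<close>, have its
  minimum in \<open>{m + 1..<s}\<close>, or be crowded in the rows or beyond them. The last three
  groups together are smaller than the part of the bound due to \<open>{m + 1..<s}\<close>.\<close>

lemma late_mem:
  assumes G: "shift_closed G" "G \<subseteq> nsets {1..n} r" and r: "1 \<le> r" "r \<le> k"
    and big: "(n choose r) - ((n - s + 1) choose r) < card G"
    and J: "2 \<le> J" "real J \<le> 2 + ln (real s)" "real s \<le> exp (real J - 1)"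
    and d: "1 \<le> d" "m + d + 1 = s" "i < d"
    and no: "reserved s J (m + 1) ` {..<r} \<notin> G"
  shows "late s J m d i ` {..<r} \<in> G"
proof (rule ccontr)
  assume notin: "late s J m d i ` {..<r} \<notin> G"
  let ?I = "{m+1..n}"
  let ?T = "\<lambda>j. {..<late s J m d i j}"
  let ?D = "\<lambda>S. {B \<in> nsets ?I r. \<exists>j\<in>S. Suc j \<le> card (B \<inter> ?T j)}"
  let ?C = "real ((n - m - 1) choose (r - 1))"
  have ks: "24 * (k * s) \<le> n" using n_ge_24 by simp
  have kks: "k * 1 \<le> k * s" using s2 by (intro mult_le_mono2) simp
  have sks: "1 * s \<le> k * s" using k1 by (intro mult_le_mono1)
  have sn: "s \<le> n" "r \<le> n - m" "m + 1 \<le> n" "d - 1 + (r - 1) \<le> n - m - 1" "d \<le> n - m"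
    using ks kks sks r d by linarith+
  have "k * (m + 1) \<le> k * s" using d by (intro mult_le_mono2) simp
  then have "k * (m + 1) \<le> n" using ks by linarith
  then have rx: "real (r - 1) \<le> dens * real (n - m - 1)"
    using ratio_le[of n r k "m + 1"] n_pos r k1 by (simp add: dens_def)
  have sm: "strict_mono (late s J m d i)"
    using s2 J d by (intro strict_mono_late) auto
  have late0: "late s J m d i 0 = m + 1 + i" by (simp add: late_def)
  have sub: "G \<subseteq> (nsets {1..n} r - nsets ?I r) \<union> (\<Union>v\<in>{m+1..<s}. with_min v G)
      \<union> (?D {1..<min J r} \<union> ?D {J..<r})"
  proof
    fix F assume F: "F \<in> G"
    then have Fn: "F \<in> nsets {1..n} r" "finite F" "F \<noteq> {}"
      using G r by (auto simp: nsets_def)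
    show "F \<in> (nsets {1..n} r - nsets ?I r) \<union> (\<Union>v\<in>{m+1..<s}. with_min v G)
        \<union> (?D {1..<min J r} \<union> ?D {J..<r})"
    proof (cases "F \<in> nsets ?I r \<and> s \<le> Min F")
      case False
      moreover have "F \<in> with_min (Min F) G"
        using F Fn by (auto simp: with_min_def)
      moreover have "m + 1 \<le> Min F" if "F \<in> nsets ?I r"
        using that Fn by (auto simp: nsets_def)
      ultimately show ?thesis using Fn(1) by (cases "F \<in> nsets ?I r") auto
    next
      case True
      obtain j where j: "j < r" "j < card (F \<inter> {1..<late s J m d i j})"
        using shift_closed_pattern[OF G F sm] late0 notin not_le by fastforce
      have "F \<inter> {1..<m + 1 + i} = {}"
        using True Fn d by auto
      then have "j \<noteq> 0" using j late0 by (cases "j = 0") auto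
      have "card (F \<inter> {1..<late s J m d i j}) \<le> card (F \<inter> ?T j)"
        using Fn by (intro card_mono) auto
      then have "Suc j \<le> card (F \<inter> ?T j)" using j by linarith
      moreover have "j \<in> {1..<min J r} \<or> j \<in> {J..<r}"
        using \<open>j \<noteq> 0\<close> j by auto
      ultimately show ?thesis using True by blast
    qed
  qed
  have fin: "finite G" "finite (nsets {1..n} r)" "\<And>S. finite (?D S)"
    using G(2) by (auto simp: finite_imp_finite_nsets intro: finite_subset)
  have "card G \<le> card ((nsets {1..n} r - nsets ?I r) \<union> (\<Union>v\<in>{m+1..<s}. with_min v G)
      \<union> (?D {1..<min J r} \<union> ?D {J..<r}))"
    using fin by (intro card_mono[OF _ sub]) (auto simp: with_min_def)
  also have "\<dots> \<le> card (nsets {1..n} r - nsets ?I r) + card (\<Union>v\<in>{m+1..<s}. with_min v G)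
      + (card (?D {1..<min J r}) + card (?D {J..<r}))"
    by (intro order_trans[OF card_Un_le] add_mono card_Un_le)
  finally have "real (card G) \<le> real (card (nsets {1..n} r - nsets ?I r))
      + real (card (\<Union>v\<in>{m+1..<s}. with_min v G))
      + (real (card (?D {1..<min J r})) + real (card (?D {J..<r})))"
    by (simp only: of_nat_add[symmetric] of_nat_le_iff)
  moreover have "real (card (nsets {1..n} r - nsets ?I r)) = real (n choose r) - real ((n - m) choose r)"
  proof -
    have "card (nsets {1..n} r - nsets ?I r) = (n choose r) - ((n - m) choose r)"
      using card_nsets_diff_initial[of "m + 1" n r] sn by (simp add: Suc_diff_Suc)
    moreover have "(n - m) choose r \<le> n choose r"
      by (intro binomial_right_mono) simp
    ultimately show ?thesis by (simp add: of_nat_diff)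
  qed
  moreover have "real (card (\<Union>v\<in>{m+1..<s}. with_min v G)) \<le> real d * (3/14 * ?C)"
  proof -
    have "card (\<Union>v\<in>{m+1..<s}. with_min v G) \<le> (\<Sum>v\<in>{m+1..<s}. card (with_min v G))"
      by (intro card_UN_le) simp
    \<comment> \<open>Non-readiness is assumed only for \<open>m + 1\<close>; monotonicity in the
      minimum carries its bound to the larger \<open>v\<close>.\<close>
    also have "\<dots> \<le> (\<Sum>v\<in>{m+1..<s}. card (with_min (m+1) G))"
      using G by (intro sum_mono card_with_min_antimono) auto
    also have "\<dots> = d * card (with_min (m+1) G)" using d by auto
    finally have "real (card (\<Union>v\<in>{m+1..<s}. with_min v G)) \<le> real d * real (card (with_min (m+1) G))"
      by (simp only: of_nat_mult[symmetric] of_nat_le_iff)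
    also have "real (card (with_min (m+1) G)) \<le> 3/14 * real ((n - (m + 1)) choose (r - 1))"
      using G r J d no by (intro card_with_min_le[where J = J]) auto
    finally show ?thesis by (simp add: mult_left_mono)
  qed
  moreover have "real (card (?D {1..<min J r})) \<le> 56/100 * real d * ?C"
  proof -
    define w where "w = real d + (real J - 1) / 2"
    let ?A = "exp 1 * w * dens"
    have A: "?A < 1" "?A\<^sup>2 / (1 - ?A) / dens \<le> 56/100 * real d"
      using early_terms_le[of "real s" "2 + ln (real s)" dens "real d" "real J"]
        s2 ln_s dens_pos s_dens_ln d J unfolding w_def by auto
    have w0: "0 \<le> w" using J d by (simp add: w_def)
    have "real (card (?D {1..<min J r}))
        \<le> (\<Sum>j\<in>{1..<min J r}. ?A ^ Suc j) / dens * real ((card ?I - 1) choose (r - 1))"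
    proof (rule card_crowded_le')
      fix j assume j: "j \<in> {1..<min J r}"
      have "?T j \<inter> ?I \<subseteq> {m+1..<s + J + (j - 1) * d + i}"
        using j by (auto simp: late_def)
      then have "card (?T j \<inter> ?I) \<le> card {m+1..<s + J + (j - 1) * d + i}"
        by (intro card_mono) auto
      also have "\<dots> = s + J + (j - 1) * d + i - (m + 1)" by simp
      \<comment> \<open>Uses \<open>s = m + d + 1\<close> and \<open>i \<le> d - 1\<close>.\<close>
      also have "\<dots> \<le> (j + 1) * d + (J - 1)"
      proof -
        obtain l where "j = Suc l" using j gr0_conv_Suc[of j] by auto
        then show ?thesis using d J by simp
      qed
      finally have "real (card (?T j \<inter> ?I)) \<le> real ((j + 1) * d + (J - 1))"
        by (simp only: of_nat_le_iff)
      also have "\<dots> = real (Suc j) * real d + (real J - 1)"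
        using J by (simp add: of_nat_diff algebra_simps)
      \<comment> \<open>As \<open>j \<ge> 1\<close>, the constant \<open>J - 1\<close> is spread
        over at least two indices; hence the half in \<open>w\<close>.\<close>
      also have "real J - 1 \<le> real (Suc j) * ((real J - 1) / 2)"
      proof -
        have "2 * ((real J - 1) / 2) \<le> real (Suc j) * ((real J - 1) / 2)"
          using j J by (intro mult_right_mono) auto
        then show ?thesis by simp
      qed
      finally show "real (card (?T j \<inter> ?I)) \<le> real (Suc j) * w"
        by (simp add: w_def distrib_left)
    qed (use rx r sn dens_pos dens_le w0 in auto)
    also have "\<dots> \<le> ?A ^ Suc 1 / (1 - ?A) / dens * real ((card ?I - 1) choose (r - 1))"
      using A w0 dens_pos by (intro mult_right_mono divide_right_mono sum_power_Suc_tail_le) auto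
    also have "\<dots> \<le> 56/100 * real d * real ((card ?I - 1) choose (r - 1))"
      using A by (intro mult_right_mono) (auto simp: power2_eq_square)
    finally show ?thesis by simp
  qed
  moreover have "real (card (?D {J..<r})) \<le> 11/100 * real d * ?C"
  proof -
    let ?A = "exp 1 * real s * dens"
    have A: "?A \<le> 1/8" "?A ^ Suc J / (1 - ?A) / dens \<le> (8/7) * (31/100) ^ J"
      using late_terms_le[of "real s" J dens] s2 J dens_pos s_dens_le by auto
    have "real (card (?D {J..<r}))
        \<le> (\<Sum>j\<in>{J..<r}. ?A ^ Suc j) / dens * real ((card ?I - 1) choose (r - 1))"
    proof (rule card_crowded_le')
      fix j assume j: "j \<in> {J..<r}"
      have "?T j \<inter> ?I \<subseteq> {m+1..<(j + 1) * s}"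
        using j J by (auto simp: late_def)
      then have "card (?T j \<inter> ?I) \<le> card {m+1..<(j + 1) * s}"
        by (intro card_mono) auto
      also have "\<dots> \<le> Suc j * s" by simp
      finally show "real (card (?T j \<inter> ?I)) \<le> real (Suc j) * real s"
        by (simp only: of_nat_mult[symmetric] of_nat_le_iff)
    qed (use rx r sn dens_pos dens_le in auto)
    also have "\<dots> \<le> ?A ^ Suc J / (1 - ?A) / dens * real ((card ?I - 1) choose (r - 1))"
      using A dens_pos by (intro mult_right_mono divide_right_mono sum_power_Suc_tail_le) auto
    also have "\<dots> \<le> 11/100 * real d * real ((card ?I - 1) choose (r - 1))"
    proof (rule mult_right_mono)
      have "(31/100 :: real) ^ J \<le> (31/100) ^ 2" using J by (intro power_decreasing) auto
      then have "?A ^ Suc J / (1 - ?A) / dens \<le> (8/7) * (31/100)\<^sup>2" using A by linarith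
      also have "\<dots> \<le> 11/100 * real d" using d by (simp add: power2_eq_square)
      finally show "?A ^ Suc J / (1 - ?A) / dens \<le> 11/100 * real d" .
    qed simp
    finally show ?thesis by simp
  qed
  moreover have "real d * (23/24 * ?C) \<le> real ((n - m) choose r) - real ((n - s + 1) choose r)"
  proof -
    \<comment> \<open>Summing Pascal's rule over \<open>u\<close> deleted points, each summand being
      at least the last one.\<close>
    have step: "real u * real ((p - u) choose (r - 1)) \<le> real (p choose r) - real ((p - u) choose r)"
      if "u \<le> p" for u p
      using that
    proof (induction u)
      case (Suc u)
      have "real ((p - u) choose r) = real ((p - Suc u) choose r) + real ((p - Suc u) choose (r - 1))"
        using Suc.prems r binomial_Suc_Suc[of "p - Suc u" "r - 1"] by (simp add: Suc_diff_Suc)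
      moreover have "real u * real ((p - Suc u) choose (r - 1)) \<le> real u * real ((p - u) choose (r - 1))"
        by (intro mult_left_mono of_nat_mono binomial_right_mono) auto
      ultimately show ?case using Suc by (simp add: algebra_simps)
    qed simp
    have "real (d - 1) * dens \<le> real s * dens"
      using d dens_pos by (intro mult_right_mono) auto
    then have "23/24 * ?C \<le> (1 - real (d - 1) * dens) * ?C"
      using s_dens_le by (intro mult_right_mono) auto
    also have "\<dots> \<le> real ((n - m - 1 - (d - 1)) choose (r - 1))"
      using sn rx by (intro binomial_sub_ge) auto
    finally have "real d * (23/24 * ?C) \<le> real d * real ((n - m - d) choose (r - 1))"
      using d by (intro mult_left_mono) auto
    also have "\<dots> \<le> real ((n - m) choose r) - real ((n - m - d) choose r)"
      using sn by (intro step) auto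
    also have "n - m - d = n - s + 1" using d sn by simp
    finally show ?thesis .
  qed
  moreover have "0 \<le> real d * ?C" by simp
  \<comment> \<open>In units of \<open>d * ?C\<close> the three groups total
    \<open>3/14 + 56/100 + 11/100\<close>, which is less than \<open>23/24\<close>.\<close>
  ultimately have "real (card G) \<le> real (n choose r) - real ((n - s + 1) choose r)"
    by (simp add: algebra_simps)
  moreover have "(n - s + 1) choose r \<le> n choose r"
    using s2 sn by (intro binomial_right_mono) auto
  ultimately show False using big by linarith
qed

end

section \<open>Disjoint members\<close>

text \<open>From index \<open>N\<close> on, the \<open>i\<close>-th sequence lives beyond \<open>J * s\<close> and there only uses the residue
  class of \<open>i\<close> modulo \<open>s\<close>, so different \<open>i\<close> can collide only in their initial parts.\<close>
definition column :: "nat \<Rightarrow> nat \<Rightarrow> nat \<Rightarrow> (nat \<Rightarrow> nat) \<Rightarrow> nat \<Rightarrow> nat \<Rightarrow> nat" where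
  "column s J N lo i j = (if j < N then lo j else (j + J - N) * s + i)"

lemma column_high:
  assumes "N \<le> j" "1 \<le> i"
  shows "J * s < column s J N lo i j"
proof -
  have "J * s \<le> (j + J - N) * s" using assms(1) by (intro mult_le_mono1) simp
  then have "J * s < (j + J - N) * s + i" using assms(2) by linarith
  then show ?thesis using assms(1) by (simp add: column_def)
qed

lemma strict_mono_column:
  assumes "\<And>j. Suc j < N \<Longrightarrow> lo j < lo (Suc j)" "\<And>j. j < N \<Longrightarrow> lo j \<le> J * s" "1 \<le> i" "1 \<le> s"
  shows "strict_mono (column s J N lo i)"
  unfolding strict_mono_Suc_iff
proof
  fix j
  consider "Suc j < N" | "j < N" "N \<le> Suc j" | "N \<le> j" by linarith
  then show "column s J N lo i j < column s J N lo i (Suc j)"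
  proof cases
    case 2
    then have "column s J N lo i j \<le> J * s" using assms by (simp add: column_def)
    then show ?thesis using column_high[OF 2(2) assms(3), of J s lo] by linarith
  next
    case 3
    then have "Suc j + J - N = Suc (j + J - N)" by simp
    then show ?thesis using 3 assms(4) by (simp add: column_def)
  qed (use assms in \<open>simp add: column_def\<close>)
qed

lemma column_neq:
  assumes "i \<in> {1..s}" "i' \<in> {1..s}" "i \<noteq> i'"
    and lo: "\<And>j. j < N \<Longrightarrow> lo j \<le> J * s" and lo': "\<And>j. j < N' \<Longrightarrow> lo' j \<le> J * s"
    and neq: "\<And>j j'. j < N \<Longrightarrow> j' < N' \<Longrightarrow> lo j \<noteq> lo' j'"
  shows "column s J N lo i j \<noteq> column s J N' lo' i' j'"
proof -
  have high: "J * s < column s J N lo i j" if "N \<le> j"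
    using that assms by (intro column_high) auto
  have high': "J * s < column s J N' lo' i' j'" if "N' \<le> j'"
    using that assms by (intro column_high) auto
  consider "j < N" "j' < N'" | "j < N" "N' \<le> j'" | "N \<le> j" "j' < N'" | "N \<le> j" "N' \<le> j'"
    by linarith
  then show ?thesis
  proof cases
    case 1
    then show ?thesis using neq by (simp add: column_def)
  next
    case 2
    then show ?thesis using high' lo[of j] by (auto simp: column_def)
  next
    case 3
    then show ?thesis using high lo'[of j'] by (auto simp: column_def)
  next
    case 4
    \<comment> \<open>Column indices run from 1 to \<open>s\<close>, so the predecessors
      \<open>u\<close>, \<open>u'\<close> are genuine remainders modulo \<open>s\<close>.\<close>
    obtain u u' where u: "i = Suc u" "i' = Suc u'" "u < s" "u' < s"
      using assms(1,2) by (cases i; cases i') auto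
    have "a * s + i \<noteq> b * s + i'" for a b
    proof
      assume "a * s + i = b * s + i'"
      then have "(a * s + u) mod s = (b * s + u') mod s" using u by simp
      then show False using u assms(3) by simp
    qed
    then show ?thesis using 4 by (simp add: column_def)
  qed
qed

section \<open>Placing the initial parts and building disjoint members\<close>

context large_ground_set
begin

text \<open>Each of the \<open>J - 2\<close> further rows takes \<open>d\<close> points and
  lengthens the start by one, and \<open>d + 1 \<le> s\<close>; the rest fits into
  \<open>2 * s\<close>.\<close>

lemma late_le:
  assumes "2 \<le> J" "1 \<le> d" "m + d + 1 = s" "i < d" "j < J"
  shows "late s J m d i j \<le> J * s"
proof -
  obtain a where a: "J = Suc (Suc a)"
    using assms(1) by (metis add_2_eq_Suc le_add_diff_inverse)
  have Js: "J * s = 2 * s + a * s" using a by simp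
  show ?thesis
  proof (cases "j = 0")
    case False
    then have "(j - 1) * d \<le> a * d" using a assms(5) by (intro mult_le_mono1) auto
    moreover have "a * (d + 1) \<le> a * s" using assms by (intro mult_le_mono2) simp
    then have "a * d + a \<le> a * s" by simp
    ultimately have "s + J + (j - 1) * d + i \<le> J * s"
      using a assms Js by linarith
    then show ?thesis using False assms by (simp add: late_def)
  qed (use assms Js in \<open>simp add: late_def\<close>)
qed

lemma late_neq:
  assumes "i < d" "i' < d" "i \<noteq> i'" "j < J" "j' < J" "m + d + 1 = s"
  shows "late s J m d i j \<noteq> late s J m d i' j'"
proof (cases "j = 0 \<or> j' = 0")
  case False
  \<comment> \<open>Within the rows, the position modulo \<open>d\<close> recovers the index of the
    family.\<close>
  have "((j - 1) * d + i) mod d = i" "((j' - 1) * d + i') mod d = i'"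
    using assms by (simp_all add: mod_less)
  then have "(j - 1) * d + i \<noteq> (j' - 1) * d + i'"
    using assms(3) by metis
  then show ?thesis using False assms by (simp add: late_def)
qed (use assms in \<open>auto simp: late_def\<close>)

theorem not_cross_dependent:
  assumes r: "\<And>i. i \<in> {1..s} \<Longrightarrow> 1 \<le> r i \<and> r i \<le> k"
    and G: "\<And>i. i \<in> {1..s} \<Longrightarrow> G i \<subseteq> nsets {1..n} (r i)"
    and closed: "\<And>i. i \<in> {1..s} \<Longrightarrow> shift_closed (G i)"
    and big: "\<And>i. i \<in> {1..s} \<Longrightarrow> (n choose r i) - ((n - s + 1) choose r i) < card (G i)"
  shows "\<not> cross_dependent s G"
proof -
  note sn = s_le_n
  \<comment> \<open>Rounding up ensures \<open>s \<le> exp (J0 - 1)\<close>, while \<open>J0\<close>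
    still stays within \<open>2 + ln s\<close>.\<close>
  define J0 where "J0 = nat \<lceil>ln (real s)\<rceil> + 1"
  have J0: "2 \<le> J0" "ln (real s) \<le> real J0 - 1" "real J0 \<le> 2 + ln (real s)"
    using ln_s unfolding J0_def by linarith+
  define P where "P J \<longleftrightarrow> J0 \<le> J \<and> (\<exists>i\<in>{1..s}. head s J ` {..<r i} \<in> G i)" for J
  have "P (max J0 k)"
  proof -
    have 1: "1 \<in> {1..s}" using s2 by simp
    have "head s (max J0 k) ` {..<r 1} \<in> G 1"
      using r[OF 1] G[OF 1] closed[OF 1] big[OF 1] s2 sn by (intro head_mem) auto
    then show ?thesis using 1 unfolding P_def by auto
  qed
  define J where "J = (LEAST J. P J)"
  have PJ: "P J" unfolding J_def using \<open>P (max J0 k)\<close> by (rule LeastI)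
  have J_le: "J \<le> max J0 k" unfolding J_def using \<open>P (max J0 k)\<close> by (rule Least_le)
  have J_min: "\<not> P M" if "M < J" for M using that not_less_Least unfolding J_def by blast
  have J2: "2 \<le> J" using PJ J0 by (simp add: P_def)
  obtain p where p: "p \<in> {1..s}" "head s J ` {..<r p} \<in> G p"
    using PJ by (auto simp: P_def)
  define ready where "ready v i \<longleftrightarrow> reserved s J v ` {..<r i} \<in> G i" for v i
  \<comment> \<open>A matching of the first elements \<open>1, ..., m\<close> with distinct families
    other than \<open>p\<close>; \<open>m\<close> is then taken as large as possible.\<close>
  define Q where "Q m f \<longleftrightarrow> inj_on f {1..m} \<and> f ` {1..m} \<subseteq> {1..s} - {p} \<and> (\<forall>v\<in>{1..m}. ready v (f v))"
    for m and f :: "nat \<Rightarrow> nat"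
  have Q_le: "m \<le> s - 1" if "Q m f" for m f
  proof -
    have "card (f ` {1..m}) \<le> card ({1..s} - {p})"
      using that by (intro card_mono) (auto simp: Q_def)
    then show ?thesis using that p by (simp add: Q_def card_image)
  qed
  define m where "m = (GREATEST m. \<exists>f. Q m f)"
  have bounded: "l \<le> s - 1" if "\<exists>f. Q l f" for l using Q_le that by blast
  have "Q 0 id" by (simp add: Q_def)
  then have "\<exists>l f. Q l f" by (intro exI)
  then have "\<exists>f. Q m f"
    unfolding m_def by (rule GreatestI_ex_nat) (rule bounded)
  then obtain f where Q: "Q m f" by blast
  have m_max: "l \<le> m" if "Q l f'" for l f'
  proof -
    from that have "\<exists>f. Q l f" by (rule exI[of "Q l" f'])
    then show ?thesis unfolding m_def by (rule Greatest_le_nat) (rule bounded)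
  qed
  define U where "U = {1..s} - {p} - f ` {1..m}"
  define d where "d = card U"
  have ms: "m + d + 1 = s"
  proof -
    have "card U = card ({1..s} - {p}) - card (f ` {1..m})"
      unfolding U_def using Q by (intro card_Diff_subset) (auto simp: Q_def)
    also have "\<dots> = s - 1 - m" using Q p by (simp add: Q_def card_image)
    finally show ?thesis using Q_le[OF Q] s2 by (simp add: d_def)
  qed
  have U: "i \<in> {1..s}" "1 \<le> d" "\<not> ready (m + 1) i" if i: "i \<in> U" for i
  proof -
    show "i \<in> {1..s}" using i by (simp add: U_def)
    show "1 \<le> d" using i unfolding d_def by (metis One_nat_def Suc_leI U_def card_gt_0_iff
        empty_iff finite_Diff finite_atLeastAtMost)
    show "\<not> ready (m + 1) i"
    proof
      assume rdy: "ready (m + 1) i"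
      \<comment> \<open>A leftover family ready for \<open>m + 1\<close> would extend the maximal
        matching.\<close>
      let ?f = "f(m + 1 := i)"
      have ins: "{1..m + 1} = insert (m + 1) {1..m}" by auto
      have old: "?f v = f v" if "v \<in> {1..m}" for v using that by simp
      have img: "?f ` {1..m} = f ` {1..m}" using old by (intro image_cong refl)
      have "inj_on ?f {1..m}"
        using Q old unfolding Q_def by (metis inj_on_cong)
      moreover have "i \<notin> f ` {1..m}" "i \<in> {1..s} - {p}" using i by (simp_all add: U_def)
      moreover have "{1..m} - {m + 1} = {1..m}" by auto
      ultimately have "inj_on ?f {1..m + 1}"
        unfolding ins inj_on_insert using img by simp
      moreover have "?f ` {1..m + 1} \<subseteq> {1..s} - {p}"
        unfolding ins image_insert img using Q \<open>i \<in> {1..s} - {p}\<close> unfolding Q_def by simp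
      moreover have "ready v (?f v)" if v: "v \<in> {1..m + 1}" for v
      proof (cases "v = m + 1")
        case False
        then have "v \<in> {1..m}" using v by simp
        then show ?thesis using Q unfolding Q_def by simp
      qed (use rdy in simp)
      ultimately have "Q (m + 1) ?f" unfolding Q_def by blast
      then show False using m_max[of "m + 1" ?f] by simp
    qed
  qed
  \<comment> \<open>If \<open>J\<close> exceeded \<open>J0\<close>, minimality would deny every
    family the sequence \<open>head s (J - 1)\<close>, and \<open>reserved_mem\<close> would make
    \<open>i\<close> ready for \<open>m + 1\<close>. Here \<open>J \<le> k\<close> follows from
    \<open>J \<le> max J0 k\<close>.\<close>
  have J_eq: "J = J0" if i: "i \<in> U" for i
  proof (rule ccontr)
    assume "J \<noteq> J0"
    then have JJ: "J0 \<le> J - 1" "J - 1 < J" "J \<le> k"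
      using PJ J_le J2 by (auto simp: P_def)
    then have "head s (J - 1) ` {..<r i} \<notin> G i"
      using J_min[of "J - 1"] U(1)[OF i] unfolding P_def by blast
    moreover have "real s \<le> exp (real (J - 1) - 1)"
    proof -
      have "ln (real s) \<le> real (J - 1) - 1" using J0 JJ by linarith
      then have "exp (ln (real s)) \<le> exp (real (J - 1) - 1)" by simp
      then show ?thesis using s2 by simp
    qed
    ultimately have "reserved s (J - 1 + 1) (m + 1) ` {..<r i} \<in> G i"
      using r[OF U(1)[OF i]] G[OF U(1)[OF i]] closed[OF U(1)[OF i]] big[OF U(1)[OF i]]
        JJ J0 ms U(2)[OF i]
      by (intro reserved_mem) auto
    then show False using U(3)[OF i] J2 by (simp add: ready_def)
  qed
  have late: "late s J m d l ` {..<r i} \<in> G i" if i: "i \<in> U" and l: "l < d" for i l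
  proof (rule late_mem)
    have "exp (ln (real s)) \<le> exp (real J0 - 1)" using J0 by simp
    then show "real s \<le> exp (real J - 1)" using s2 J_eq[OF i] by simp
    show "reserved s J (m + 1) ` {..<r i} \<notin> G i" using U(3)[OF i] by (simp add: ready_def)
  qed (use r[OF U(1)[OF i]] G[OF U(1)[OF i]] closed[OF U(1)[OF i]] big[OF U(1)[OF i]]
      J0 J_eq[OF i] ms l U(2)[OF i] in auto)
  have "finite U" by (simp add: U_def)
  then obtain g where g: "bij_betw g U {0..<d}"
    unfolding d_def using ex_bij_betw_finite_nat by blast
  have g_less: "g i < d" if "i \<in> U" for i
    using g that bij_betwE by fastforce
  have g_inj: "g i \<noteq> g i'" if "i \<in> U" "i' \<in> U" "i \<noteq> i'" for i i'
    using g that by (meson bij_betw_imp_inj_on inj_onD)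
  define h where "h = the_inv_into {1..m} f"
  have h: "h i \<in> {1..m}" "f (h i) = i" if "i \<in> f ` {1..m}" for i
  proof -
    have inj: "inj_on f {1..m}" using Q by (simp add: Q_def)
    from that obtain v where v: "i = f v" "v \<in> {1..m}" by (rule imageE)
    then have "h i = v" using the_inv_into_f_f[OF inj v(2)] by (simp add: h_def)
    then show "h i \<in> {1..m}" "f (h i) = i" using v by simp_all
  qed
  \<comment> \<open>\<open>N\<close> is the length of the initial part: a single point for matched
    families, \<open>J\<close> points for \<open>p\<close> and the leftover ones.\<close>
  define N where "N i = (if i \<in> f ` {1..m} then 1 else J)" for i
  define lo where "lo i = (if i = p then (\<lambda>j. s + j) else if i \<in> f ` {1..m} then (\<lambda>_. h i)
    else late s J m d (g i))" for i
  have cases: "i = p \<or> i \<in> f ` {1..m} \<or> i \<in> U" if "i \<in> {1..s}" for i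
    using that by (auto simp: U_def)
  have lo_p: "lo p = (\<lambda>j. s + j)" "N p = J"
    using Q by (auto simp: lo_def N_def Q_def)
  have lo_f: "lo i = (\<lambda>_. h i)" "N i = 1" "h i \<le> m" "1 \<le> h i" "i \<noteq> p" if "i \<in> f ` {1..m}" for i
    using Q that h[OF that] by (auto simp: lo_def N_def Q_def)
  have lo_U: "lo i = late s J m d (g i)" "N i = J" if "i \<in> U" for i
    using that by (auto simp: lo_def N_def U_def)
  have Js: "s + J \<le> J * s + 1"
  proof -
    have "(J - 1) * 1 \<le> (J - 1) * (s - 1)" using s2 by (intro mult_le_mono2) simp
    then show ?thesis using J2 s2 by (simp add: algebra_simps diff_mult_distrib diff_mult_distrib2)
  qed
  have lo_le: "lo i j \<le> J * s" if ij: "i \<in> {1..s}" "j < N i" for i j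
  proof -
    consider "i = p" | "i \<in> f ` {1..m}" | "i \<in> U" using cases[OF ij(1)] by blast
    then show ?thesis
    proof cases
      case 1
      then show ?thesis using lo_p ij Js by auto
    next
      case 2
      then show ?thesis using lo_f[OF 2] ij Js ms J2 by auto
    next
      case 3
      then show ?thesis using lo_U[OF 3] ij late_le g_less U(2) ms J2 by auto
    qed
  qed
  have lo_mono: "lo i j < lo i (Suc j)" if ij: "i \<in> {1..s}" "Suc j < N i" for i j
  proof -
    consider "i = p" | "i \<in> f ` {1..m}" | "i \<in> U" using cases[OF ij(1)] by blast
    then show ?thesis
    proof cases
      case 3
      then have "strict_mono (late s J m d (g i))"
        using s2 J2 U(2) ms g_less by (intro strict_mono_late) auto
      then show ?thesis using lo_U[OF 3] by (simp add: strict_mono_Suc_iff)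
    qed (use ij lo_p lo_f in auto)
  qed
  \<comment> \<open>The initial parts of leftover families avoid both the matched points up to
    \<open>m\<close> and the interval \<open>s, ..., s + J - 1\<close> used by
    \<open>p\<close>.\<close>
  have late_bounds: "late s J m d l j \<in> {m<..<s} \<union> {s + J..}" if "l < d" "j < J" for l j
    using that ms by (auto simp: late_def)
  have lo_neq: "lo i j \<noteq> lo i' j'"
    if ii: "i \<in> {1..s}" "i' \<in> {1..s}" "i \<noteq> i'" and jj: "j < N i" "j' < N i'" for i i' j j'
  proof -
    have head_U: "lo p j \<noteq> lo i' j'" if "i' \<in> U" "j < N p" "j' < N i'" for i' j j'
      using late_bounds[OF g_less[OF that(1)], of j'] that lo_p lo_U[OF that(1)] by auto
    have f_U: "lo i j \<noteq> lo i' j'" if "i \<in> f ` {1..m}" "i' \<in> U" "j < N i" "j' < N i'" for i i' j j'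
      using late_bounds[OF g_less[OF that(2)], of j'] that lo_f[OF that(1)] lo_U[OF that(2)] ms by auto
    have p_f: "lo p j \<noteq> lo i' j'" if "i' \<in> f ` {1..m}" for i' j j'
      using lo_p lo_f[OF that] ms by auto
    have f_f: "lo i j \<noteq> lo i' j'" if "i \<in> f ` {1..m}" "i' \<in> f ` {1..m}" "i \<noteq> i'" for i i' j j'
      using lo_f[OF that(1)] lo_f[OF that(2)] h(2)[OF that(1)] h(2)[OF that(2)] that(3) by auto
    have U_U: "lo i j \<noteq> lo i' j'" if "i \<in> U" "i' \<in> U" "i \<noteq> i'" "j < N i" "j' < N i'" for i i' j j'
      using lo_U[OF that(1)] lo_U[OF that(2)] late_neq g_less g_inj ms that by auto
    show ?thesis
      using cases[OF ii(1)] cases[OF ii(2)] head_U f_U p_f f_f U_U ii(3) jj by metis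
  qed
  define A where "A i = column s J (N i) (lo i) i ` {..<r i}" for i
  have "A i \<in> G i" if i: "i \<in> {1..s}" for i
  proof -
    have sm: "strict_mono (column s J (N i) (lo i) i)"
      using lo_mono[OF i] lo_le[OF i] i s2 by (intro strict_mono_column) auto
    have pos: "1 \<le> column s J (N i) (lo i) i 0"
    proof -
      have "1 \<le> lo i 0"
        using cases[OF i] lo_p lo_f[of i] lo_U[of i] s2 by (auto simp: late_def)
      then show ?thesis using i by (simp add: column_def)
    qed
    note mono = shift_closed_pattern_mono[OF closed[OF i] G[OF i] _ _ sm pos]
    \<comment> \<open>The two possible values of \<open>N\<close>: in each case the point of residue
      class \<open>i\<close> is at most the end of its block, since
      \<open>i \<le> s\<close>.\<close>
    have col: "(j + J - J) * s + i \<le> (j + 1) * s" "(j + J - 1) * s + i \<le> (J + j) * s" for j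
    proof -
      obtain a where "J = Suc a" using J2 by (metis Suc_le_D numeral_2_eq_2)
      then show "(j + J - J) * s + i \<le> (j + 1) * s" "(j + J - 1) * s + i \<le> (J + j) * s"
        using i by (simp_all add: algebra_simps)
    qed
    consider "i = p" | "i \<in> f ` {1..m}" | "i \<in> U" using cases[OF i] by blast
    then show ?thesis
      unfolding A_def
    proof cases
      case 1
      show "column s J (N i) (lo i) i ` {..<r i} \<in> G i"
      proof (rule mono)
        show "strict_mono (head s J)" "head s J ` {..<r i} \<in> G i"
          using p 1 s2 strict_mono_head by auto
        show "column s J (N i) (lo i) i j \<le> head s J j" for j
          using 1 lo_p col(1)[of j] by (simp add: column_def head_def)
      qed
    next
      case 2
      show "column s J (N i) (lo i) i ` {..<r i} \<in> G i"
      proof (rule mono)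
        have "h i < s" using lo_f[OF 2] ms by simp
        then show "strict_mono (reserved s J (h i))"
          using s2 by (intro strict_mono_reserved) auto
        show "reserved s J (h i) ` {..<r i} \<in> G i"
          using Q h[OF 2] unfolding Q_def ready_def by metis
        show "column s J (N i) (lo i) i j \<le> reserved s J (h i) j" for j
          using lo_f[OF 2] col(2)[of j] by (simp add: column_def reserved_def)
      qed
    next
      case 3
      show "column s J (N i) (lo i) i ` {..<r i} \<in> G i"
      proof (rule mono)
        show "strict_mono (late s J m d (g i))"
          using s2 J2 U(2)[OF 3] ms g_less[OF 3] by (intro strict_mono_late) auto
        show "late s J m d (g i) ` {..<r i} \<in> G i" using late 3 g_less by blast
        show "column s J (N i) (lo i) i j \<le> late s J m d (g i) j" for j
          using lo_U[OF 3] col(1)[of j] J2 by (simp add: column_def late_def)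
      qed
    qed
  qed
  moreover have "disjoint_family_on A {1..s}"
    unfolding disjoint_family_on_def A_def
  proof (intro ballI impI)
    fix i i' assume ii: "i \<in> {1..s}" "i' \<in> {1..s}" "i \<noteq> i'"
    have "column s J (N i) (lo i) i j \<noteq> column s J (N i') (lo i') i' j'" for j j'
      using ii lo_le lo_neq by (intro column_neq) auto
    then show "column s J (N i) (lo i) i ` {..<r i} \<inter> column s J (N i') (lo i') i' ` {..<r i'} = {}"
      by auto
  qed
  ultimately show ?thesis unfolding cross_dependent_def by blast
qed

end

section \<open>From arbitrary to shifted families, with \<open>s = 1\<close> apart\<close>

theorem theorem5p6:
  fixes n s kmax :: nat
    and k :: "nat \<Rightarrow> nat"
    and \<F> :: "nat \<Rightarrow> nat set set"
  assumes "s \<ge> 1"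
    and "\<And>i. i \<in> {1..s} \<Longrightarrow> k i \<ge> 1"
    and "kmax = Max (k ` {1..s})"
    and "real n \<ge> 12 * real kmax * real s * ln (exp 1 ^ 2 * real s)"
    and "\<And>i. i \<in> {1..s} \<Longrightarrow> \<F> i \<subseteq> nsets {1..n} (k i)"
    and "cross_dependent s \<F>"
  shows "\<exists>i\<in>{1..s}. real (card (\<F> i)) \<le>
           real (n choose k i) - real ((n - s + 1) choose k i)"
proof (cases "s = 1")
  case True
  \<comment> \<open>For \<open>s = 1\<close> the bound is 0, and any member alone would be a
    disjoint choice.\<close>
  have "\<F> 1 = {}"
  proof (rule ccontr)
    assume "\<F> 1 \<noteq> {}"
    then obtain A where "A \<in> \<F> 1" by blast
    then have "\<forall>i\<in>{1..s}. A \<in> \<F> i" "disjoint_family_on (\<lambda>_. A) {1..s}"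
      using True by (auto simp: disjoint_family_on_def)
    then have "\<exists>F. (\<forall>i\<in>{1..s}. F i \<in> \<F> i) \<and> disjoint_family_on F {1..s}"
      by (intro exI[of _ "\<lambda>_. A"] conjI)
    then show False using assms(6) unfolding cross_dependent_def by simp
  qed
  moreover have kmax: "1 \<le> kmax"
    using assms(2)[of 1] assms(3) True by simp
  \<comment> \<open>Truncated subtraction: \<open>n - 1 + 1 = n\<close> requires \<open>n\<close> to
    be positive.\<close>
  then have "0 < real n"
    using assms(4) True by (simp add: ln_mult ln_realpow)
  ultimately show ?thesis using True by auto
next
  case False
  have k_le: "k i \<le> kmax" if "i \<in> {1..s}" for i
    using that assms(3) by simp
  have ln_eq: "ln (exp 1 ^ 2 * real s) = 2 + ln (real s)"
    using assms(1) by (simp add: ln_mult ln_realpow)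
  interpret large_ground_set n kmax s
  proof
    show "1 \<le> kmax" using k_le[of 1] assms(1,2) by fastforce
  qed (use False assms(1,4) ln_eq in auto)
  obtain \<G> where \<G>: "\<And>i. i \<in> {1..s} \<Longrightarrow> \<G> i \<subseteq> nsets {1..n} (k i)"
      "\<And>i. i \<in> {1..s} \<Longrightarrow> card (\<G> i) = card (\<F> i)" "cross_dependent s \<G>"
      "\<And>i. i \<in> {1..s} \<Longrightarrow> shift_closed (\<G> i)"
    using ex_shift_closed_families[OF assms(5,6)] by blast
  obtain i where i: "i \<in> {1..s}" "card (\<F> i) \<le> (n choose k i) - ((n - s + 1) choose k i)"
    using not_cross_dependent[of k \<G>] \<G> k_le assms(2) by (metis not_le)
  have "(n - s + 1) choose k i \<le> n choose k i"
    using assms(1) s_le_n by (intro binomial_right_mono) simp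
  then show ?thesis using i by (intro bexI[of _ i]) linarith+
qed

end
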